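(* There exists a constant $K_{11}>0$, depending only on $\gamma$, $\|f\|$ and $L$, such that the following holds. If $m\in\mathbb{N}$ satisfies $$m\ \geq\ \frac{L}{2\pi}K_{11}-1,$$ then the projection $P_m$ is determining for the damped driven NLS: whenever $u_1,u_2:\mathbb{R}\to H^2_{per}$ are two complete trajectories lying in the global attractor $\mathcal{A}$ and $P_m u_1(t)=P_m u_2(t)$ for all $t\in\mathbb{R}$, then $u_1(t)=u_2(t)$ for all $t\in\mathbb{R}$.
   Context: Fix $0<L<\infty$, $\gamma>0$ and a time-independent $f\in L^2_{per}[0,L]$, $f\neq 0$. The damped driven nonlinear Schrödinger equation (NLS) is $$iu_t+u_{xx}+|u|^2u+i\gamma u=f,\qquad u(t,x)=u(t,x+L),$$ with complex-valued $u$. $H^k_{per}$ denotes the $L$-periodic Sobolev space of order $k$; $\|\cdot\|$ is the $L^2(0,L)$ norm, $\|u\|_{H^1}^2=\|u\|^2+\|u_x\|^2$, $\|u\|_{H^2}^2=\|u\|^2+\|u_{xx}\|^2$. The NLS generates a solution semigroup on $H^2_{per}$ possessing a global attractor $\mathcal{A}\subset H^2_{per}$ (the maximal compact invariant set); a complete trajectory in $\mathcal{A}$ is a solution $u:\mathbb{R}\to H^2_{per}$ of the NLS defined for all $t\in\mathbb{R}$ with $u(t)\in\mathcal{A}$ for all $t$. For $m\in\mathbb{N}$, $P_m$ denotes the $L^2$-orthogonal projection onto $H_m=\mathrm{span}\{e^{2\pi ikx/L}: |k|\le m\}$. *)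

theory Defs
  imports "HOL-Analysis.Analysis"
begin

text \<open>
  Periodic functions on [0,L] are represented by their Fourier coefficients
  with respect to the basis e_k(x) = exp(2 pi i k x / L), k in Z:
  u(x) = sum_k c_k e_k(x).  Thus a state is a map  int => complex.
  Parseval: the L2(0,L) norm is  sqrt (L * sum_k |c_k|^2).
\<close>

type_synonym fcoef = "int \<Rightarrow> complex"

definition wavenum :: "real \<Rightarrow> int \<Rightarrow> real" where
  "wavenum L k = 2 * pi * real_of_int k / L"

definition in_L2per :: "fcoef \<Rightarrow> bool" where
  "in_L2per c \<longleftrightarrow> (\<lambda>k. (cmod (c k))\<^sup>2) summable_on UNIV"

definition dxx :: "real \<Rightarrow> fcoef \<Rightarrow> fcoef" where
  "dxx L c = (\<lambda>k. - complex_of_real ((wavenum L k)\<^sup>2) * c k)"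

definition in_H2per :: "real \<Rightarrow> fcoef \<Rightarrow> bool" where
  "in_H2per L c \<longleftrightarrow> in_L2per c \<and> in_L2per (dxx L c)"

definition L2norm :: "real \<Rightarrow> fcoef \<Rightarrow> real" where
  "L2norm L c = sqrt (L * (\<Sum>\<^sub>\<infinity>k\<in>UNIV. (cmod (c k))\<^sup>2))"

definition H2norm :: "real \<Rightarrow> fcoef \<Rightarrow> real" where
  "H2norm L c = sqrt ((L2norm L c)\<^sup>2 + (L2norm L (dxx L c))\<^sup>2)"

text \<open>Fourier coefficients of |u|^2 u = u * u * conj u.\<close>
definition cubic :: "fcoef \<Rightarrow> fcoef" where
  "cubic c = (\<lambda>k. infsum (\<lambda>(a, b). c a * c b * cnj (c (a + b - k))) UNIV)"

definition is_nls_solution ::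
  "real \<Rightarrow> real \<Rightarrow> fcoef \<Rightarrow> real set \<Rightarrow> (real \<Rightarrow> fcoef) \<Rightarrow> bool" where
  "is_nls_solution L \<gamma> f I u \<longleftrightarrow>
     (\<forall>t\<in>I. in_H2per L (u t)) \<and>
     (\<forall>t\<in>I. ((\<lambda>s. H2norm L (\<lambda>k. u s k - u t k)) \<longlongrightarrow> 0) (at t within I)) \<and>
     (\<exists>ut. \<forall>t\<in>I. in_L2per (ut t) \<and>
        ((\<lambda>h. L2norm L (\<lambda>k. (u (t + h) k - u t k) / complex_of_real h - ut t k))
            \<longlongrightarrow> 0) (at 0 within {h. t + h \<in> I}) \<and>
        (\<forall>k. \<i> * ut t k + dxx L (u t) k + cubic (u t) k + \<i> * complex_of_real \<gamma> * u t k = f k))"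

definition nls_S :: "real \<Rightarrow> real \<Rightarrow> fcoef \<Rightarrow> real \<Rightarrow> fcoef \<Rightarrow> fcoef" where
  "nls_S L \<gamma> f t u0 =
     (THE v. \<exists>u. is_nls_solution L \<gamma> f {0..} u \<and> u 0 = u0 \<and> u t = v)"

definition H2_compact :: "real \<Rightarrow> fcoef set \<Rightarrow> bool" where
  "H2_compact L B \<longleftrightarrow> B \<subseteq> {c. in_H2per L c} \<and>
     (\<forall>s :: nat \<Rightarrow> fcoef. (\<forall>n. s n \<in> B) \<longrightarrow>
        (\<exists>(r :: nat \<Rightarrow> nat) b. strict_mono r \<and> b \<in> B \<and>
           (\<lambda>n. H2norm L (\<lambda>k. s (r n) k - b k)) \<longlonglongrightarrow> 0))"

definition nls_invariant :: "real \<Rightarrow> real \<Rightarrow> fcoef \<Rightarrow> fcoef set \<Rightarrow> bool" where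
  "nls_invariant L \<gamma> f B \<longleftrightarrow> (\<forall>t\<ge>0. nls_S L \<gamma> f t ` B = B)"

definition is_global_attractor :: "real \<Rightarrow> real \<Rightarrow> fcoef \<Rightarrow> fcoef set \<Rightarrow> bool" where
  "is_global_attractor L \<gamma> f A \<longleftrightarrow>
     H2_compact L A \<and> nls_invariant L \<gamma> f A \<and>
     (\<forall>B. H2_compact L B \<and> nls_invariant L \<gamma> f B \<longrightarrow> B \<subseteq> A)"

definition complete_trajectory_in ::
  "real \<Rightarrow> real \<Rightarrow> fcoef \<Rightarrow> fcoef set \<Rightarrow> (real \<Rightarrow> fcoef) \<Rightarrow> bool" where
  "complete_trajectory_in L \<gamma> f A u \<longleftrightarrow> is_nls_solution L \<gamma> f UNIV u \<and> (\<forall>t. u t \<in> A)"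

definition proj :: "nat \<Rightarrow> fcoef \<Rightarrow> fcoef" where
  "proj m c = (\<lambda>k. if \<bar>k\<bar> \<le> int m then c k else 0)"

end

theory Submission
  imports Defs
begin

text \<open>
  On a bounded complete trajectory the mass identity and the Hamiltonian
  |u_x|^2 - |u|_4^4 / 2 + 2 Re (f, u) obey damped differential inequalities, so backward
  Gronwall bounds u in H1 by a constant depending only on \<gamma>, L and the norm of f.
  For the difference w = u - v of two such trajectories, the second-order energy
  H = |w_x|^2 - \<integral> (|u|^2 + |v|^2) |w|^2 - Re \<integral> u v conj(w)^2 satisfies H' = - 2 \<gamma> H - R,
  where R collects the terms with u_t or v_t. Moving one derivative off u_xx bounds R by
  C |w|_sup |w_x|; if w has only high modes, |w|_sup \<le> \<epsilon> |w_x|, hence H is comparable to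
  |w_x|^2 and H' \<le> - \<gamma> H on the whole line, which forces w = 0.
  On Fourier coefficients the l1 norm takes the role of the sup norm.
\<close>

section \<open>Sequence norms and the quadrilinear form\<close>

text \<open>The obstacle is regularity. Trajectories are only H2 in space and u_t exists only in L2,
  so u_x and w_x cannot simply be differentiated in time, and no bound on u_xx by the data is
  derived that could enter the constant. Each energy is therefore differentiated as a form in which
  one argument has a derivative in L2 while the others are continuous in a stronger norm. The shape
  of H is dictated by the equation for w, which reads w_t = - i G - \<gamma> w, where at each time G
  depends on w through a symmetric real-linear operator. H is the quadratic form of that operator,
  so the pairing of G with i G, which would lose derivatives, is zero, and only derivatives falling
  on the coefficients u and v survive. Compactness of the attractor supplies boundedness in time,
  but with a bound of unknown size. Gronwall started at minus infinity forgets that size, and so the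
  final constants depend on the data alone. The small factor \<epsilon> for high modes is a tail of
  the convergent series of 1/k^2.\<close>

definition in_l1 :: "fcoef \<Rightarrow> bool" where
  "in_l1 c \<longleftrightarrow> (\<lambda>k. cmod (c k)) summable_on UNIV"

definition l1norm :: "fcoef \<Rightarrow> real" where
  "l1norm c = (\<Sum>\<^sub>\<infinity>k. cmod (c k))"

text \<open>Without the factor L of \<open>L2norm\<close>, so that estimates on coefficients carry
  no powers of L; the two norms differ by the factor sqrt L.\<close>

definition l2norm :: "fcoef \<Rightarrow> real" where
  "l2norm c = sqrt (\<Sum>\<^sub>\<infinity>k. (cmod (c k))\<^sup>2)"

text \<open>The real part of the complex inner product. The energies are real functionals, and
  multiplication by i is skew for this product, which is what removes the conservative
  terms.\<close>

definition rinner :: "fcoef \<Rightarrow> fcoef \<Rightarrow> real" where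
  "rinner a b = (\<Sum>\<^sub>\<infinity>k. a k \<bullet> b k)"

text \<open>Coefficients of the pointwise complex conjugate.\<close>

definition star :: "fcoef \<Rightarrow> fcoef" where
  "star c = (\<lambda>k. cnj (c (- k)))"

lemma l1norm_nonneg [simp]: "0 \<le> l1norm c"
  unfolding l1norm_def by (simp add: infsum_nonneg)

lemma l2norm_nonneg [simp]: "0 \<le> l2norm c"
  unfolding l2norm_def by (simp add: infsum_nonneg)

lemma l2norm_squared: "(l2norm c)\<^sup>2 = (\<Sum>\<^sub>\<infinity>k. (cmod (c k))\<^sup>2)"
  unfolding l2norm_def by (simp add: infsum_nonneg)

lemma sum_le_l1norm: "in_l1 c \<Longrightarrow> finite S \<Longrightarrow> (\<Sum>k\<in>S. cmod (c k)) \<le> l1norm c"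
  unfolding in_l1_def l1norm_def by (rule finite_sum_le_infsum) auto

lemma L2_set_le_l2norm: "in_L2per c \<Longrightarrow> finite S \<Longrightarrow> L2_set (\<lambda>k. cmod (c k)) S \<le> l2norm c"
  unfolding in_L2per_def l2norm_def L2_set_def
  by (intro real_sqrt_le_mono finite_sum_le_infsum) auto

text \<open>A divergent infinite sum has the default value 0, so membership must accompany every
  norm estimate. Here and in the l2 version one uniform bound on finite partial sums yields both,
  and finite inequalities carry over.\<close>

lemma l1norm_bound:
  assumes "\<And>S. finite S \<Longrightarrow> (\<Sum>k\<in>S. cmod (c k)) \<le> B"
  shows "in_l1 c" "l1norm c \<le> B"
proof -
  show "in_l1 c" unfolding in_l1_def
    by (rule nonneg_bdd_above_summable_on) (auto intro!: bdd_aboveI2 assms)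
  then show "l1norm c \<le> B" unfolding in_l1_def l1norm_def
    by (intro infsum_le_finite_sums assms)
qed

lemma l2norm_bound:
  assumes "\<And>S. finite S \<Longrightarrow> L2_set (\<lambda>k. cmod (c k)) S \<le> B"
  shows "in_L2per c" "l2norm c \<le> B"
proof -
  have B: "0 \<le> B" using assms[of "{}"] by simp
  have sq: "(\<Sum>k\<in>S. (cmod (c k))\<^sup>2) \<le> B\<^sup>2" if "finite S" for S
    using assms[OF that] B unfolding L2_set_def by (intro sqrt_le_D)
  show *: "in_L2per c" unfolding in_L2per_def
    by (rule nonneg_bdd_above_summable_on) (auto intro!: bdd_aboveI2 sq)
  have "(\<Sum>\<^sub>\<infinity>k. (cmod (c k))\<^sup>2) \<le> B\<^sup>2"
    using * unfolding in_L2per_def by (intro infsum_le_finite_sums sq)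
  then show "l2norm c \<le> B" unfolding l2norm_def using B real_le_lsqrt by blast
qed

lemma in_L2per_add: "in_L2per a \<Longrightarrow> in_L2per b \<Longrightarrow> in_L2per (\<lambda>k. a k + b k)"
  and l2norm_triangle: "in_L2per a \<Longrightarrow> in_L2per b \<Longrightarrow> l2norm (\<lambda>k. a k + b k) \<le> l2norm a + l2norm b"
proof -
  have *: "L2_set (\<lambda>k. cmod (a k + b k)) S \<le> l2norm a + l2norm b"
    if "in_L2per a" "in_L2per b" "finite S" for S
  proof -
    have "L2_set (\<lambda>k. cmod (a k + b k)) S \<le> L2_set (\<lambda>k. cmod (a k) + cmod (b k)) S"
      by (intro L2_set_mono norm_triangle_ineq norm_ge_zero)
    also have "\<dots> \<le> L2_set (\<lambda>k. cmod (a k)) S + L2_set (\<lambda>k. cmod (b k)) S"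
      by (rule L2_set_triangle_ineq)
    also have "\<dots> \<le> l2norm a + l2norm b" using that by (intro add_mono L2_set_le_l2norm)
    finally show ?thesis .
  qed
  show "in_L2per a \<Longrightarrow> in_L2per b \<Longrightarrow> in_L2per (\<lambda>k. a k + b k)"
    by (rule l2norm_bound(1)) (rule *)
  show "in_L2per a \<Longrightarrow> in_L2per b \<Longrightarrow> l2norm (\<lambda>k. a k + b k) \<le> l2norm a + l2norm b"
    by (rule l2norm_bound(2)) (rule *)
qed

lemma in_l1_add: "in_l1 a \<Longrightarrow> in_l1 b \<Longrightarrow> in_l1 (\<lambda>k. a k + b k)"
  and l1norm_triangle: "in_l1 a \<Longrightarrow> in_l1 b \<Longrightarrow> l1norm (\<lambda>k. a k + b k) \<le> l1norm a + l1norm b"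
proof -
  have *: "(\<Sum>k\<in>S. cmod (a k + b k)) \<le> l1norm a + l1norm b"
    if "in_l1 a" "in_l1 b" "finite S" for S
  proof -
    have "(\<Sum>k\<in>S. cmod (a k + b k)) \<le> (\<Sum>k\<in>S. cmod (a k) + cmod (b k))"
      by (intro sum_mono norm_triangle_ineq)
    also have "\<dots> \<le> l1norm a + l1norm b"
      unfolding sum.distrib using that by (intro add_mono sum_le_l1norm)
    finally show ?thesis .
  qed
  show "in_l1 a \<Longrightarrow> in_l1 b \<Longrightarrow> in_l1 (\<lambda>k. a k + b k)"
    by (rule l1norm_bound(1)) (rule *)
  show "in_l1 a \<Longrightarrow> in_l1 b \<Longrightarrow> l1norm (\<lambda>k. a k + b k) \<le> l1norm a + l1norm b"
    by (rule l1norm_bound(2)) (rule *)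
qed

lemma in_L2per_scale [intro]: "in_L2per a \<Longrightarrow> in_L2per (\<lambda>k. z * a k)"
  unfolding in_L2per_def by (simp add: norm_mult power_mult_distrib summable_on_cmult_right)

lemma l2norm_scale: "l2norm (\<lambda>k. z * a k) = cmod z * l2norm a"
  unfolding l2norm_def by (simp add: norm_mult power_mult_distrib infsum_cmult_right' real_sqrt_mult)

lemma in_L2per_uminus [intro]: "in_L2per a \<Longrightarrow> in_L2per (\<lambda>k. - a k)"
  unfolding in_L2per_def by simp

lemma l2norm_uminus [simp]: "l2norm (\<lambda>k. - a k) = l2norm a"
  unfolding l2norm_def by simp

lemma in_l1_uminus [intro]: "in_l1 a \<Longrightarrow> in_l1 (\<lambda>k. - a k)"
  unfolding in_l1_def by simp

lemma l1norm_uminus [simp]: "l1norm (\<lambda>k. - a k) = l1norm a"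
  unfolding l1norm_def by simp

lemma in_L2per_diff: "in_L2per a \<Longrightarrow> in_L2per b \<Longrightarrow> in_L2per (\<lambda>k. a k - b k)"
  using in_L2per_add[of a "\<lambda>k. - b k"] in_L2per_uminus by simp

lemma in_l1_diff: "in_l1 a \<Longrightarrow> in_l1 b \<Longrightarrow> in_l1 (\<lambda>k. a k - b k)"
  using in_l1_add[of a "\<lambda>k. - b k"] in_l1_uminus by simp

lemma l2norm_triangle_diff: "in_L2per a \<Longrightarrow> in_L2per b \<Longrightarrow> l2norm (\<lambda>k. a k - b k) \<le> l2norm a + l2norm b"
  using l2norm_triangle[of a "\<lambda>k. - b k"] in_L2per_uminus by simp

lemma l2norm_triangle_sub: "in_L2per a \<Longrightarrow> in_L2per b \<Longrightarrow> l2norm a \<le> l2norm b + l2norm (\<lambda>k. a k - b k)"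
  using l2norm_triangle[of b "\<lambda>k. a k - b k"] in_L2per_diff by simp

lemma l1norm_triangle_sub: "in_l1 a \<Longrightarrow> in_l1 b \<Longrightarrow> l1norm a \<le> l1norm b + l1norm (\<lambda>k. a k - b k)"
  using l1norm_triangle[of b "\<lambda>k. a k - b k"] in_l1_diff by simp

lemma in_l1_imp_L2per: "in_l1 a \<Longrightarrow> in_L2per a"
  and l2norm_le_l1norm: "in_l1 a \<Longrightarrow> l2norm a \<le> l1norm a"
proof -
  have *: "L2_set (\<lambda>k. cmod (a k)) S \<le> l1norm a" if "in_l1 a" "finite S" for S
    using L2_set_le_sum[of S "\<lambda>k. cmod (a k)"] sum_le_l1norm[OF that] by simp
  show "in_l1 a \<Longrightarrow> in_L2per a" by (rule l2norm_bound(1)) (rule *)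
  show "in_l1 a \<Longrightarrow> l2norm a \<le> l1norm a" by (rule l2norm_bound(2)) (rule *)
qed

lemma cauchy_schwarz_summable: "in_L2per a \<Longrightarrow> in_L2per b \<Longrightarrow> in_l1 (\<lambda>k. a k * b k)"
  and cauchy_schwarz: "in_L2per a \<Longrightarrow> in_L2per b \<Longrightarrow> l1norm (\<lambda>k. a k * b k) \<le> l2norm a * l2norm b"
proof -
  have *: "(\<Sum>k\<in>S. cmod (a k * b k)) \<le> l2norm a * l2norm b"
    if "in_L2per a" "in_L2per b" "finite S" for S
  proof -
    have "(\<Sum>k\<in>S. cmod (a k * b k)) \<le> L2_set (\<lambda>k. cmod (a k)) S * L2_set (\<lambda>k. cmod (b k)) S"
      using L2_set_mult_ineq[of "\<lambda>k. cmod (a k)" "\<lambda>k. cmod (b k)" S] by (simp add: norm_mult)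
    also have "\<dots> \<le> l2norm a * l2norm b" using that by (intro mult_mono L2_set_le_l2norm) auto
    finally show ?thesis .
  qed
  show "in_L2per a \<Longrightarrow> in_L2per b \<Longrightarrow> in_l1 (\<lambda>k. a k * b k)"
    by (rule l1norm_bound(1)) (rule *)
  show "in_L2per a \<Longrightarrow> in_L2per b \<Longrightarrow> l1norm (\<lambda>k. a k * b k) \<le> l2norm a * l2norm b"
    by (rule l1norm_bound(2)) (rule *)
qed

lemma in_L2per_cnj [simp]: "in_L2per (\<lambda>k. cnj (b k)) = in_L2per b"
  unfolding in_L2per_def by simp

lemma l2norm_cnj [simp]: "l2norm (\<lambda>k. cnj (b k)) = l2norm b"
  unfolding l2norm_def by simp

lemma rinner_summable:
  assumes "in_L2per a" "in_L2per b"
  shows "(\<lambda>k. a k \<bullet> b k) summable_on UNIV" "(\<lambda>k. cmod (a k * cnj (b k))) summable_on UNIV"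
proof -
  have *: "(\<lambda>k. cmod (a k * cnj (b k))) summable_on UNIV"
    using cauchy_schwarz_summable[of a "\<lambda>k. cnj (b k)"] assms unfolding in_l1_def by simp
  then show "(\<lambda>k. cmod (a k * cnj (b k))) summable_on UNIV" by simp
  have le: "norm (a k \<bullet> b k) \<le> cmod (a k * cnj (b k))" for k
    using Cauchy_Schwarz_ineq2[of "a k" "b k"] by (simp add: norm_mult)
  show "(\<lambda>k. a k \<bullet> b k) summable_on UNIV"
    by (rule Infinite_Sum.abs_summable_summable[OF Infinite_Sum.abs_summable_on_comparison_test'[OF * le]])
qed

lemma rinner_bound:
  assumes "in_L2per a" "in_L2per b"
  shows "\<bar>rinner a b\<bar> \<le> l2norm a * l2norm b"
proof -
  note s = rinner_summable(2)[OF assms]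
  have "norm (rinner a b) \<le> (\<Sum>\<^sub>\<infinity>k. cmod (a k * cnj (b k)))"
    unfolding rinner_def using s
    by (intro norm_infsum_le[OF has_sum_infsum has_sum_infsum] rinner_summable assms)
       (use Cauchy_Schwarz_ineq2 in \<open>auto simp: norm_mult\<close>)
  also have "\<dots> \<le> l2norm a * l2norm b"
    using cauchy_schwarz[of a "\<lambda>k. cnj (b k)"] assms unfolding l1norm_def by simp
  finally show ?thesis by simp
qed

lemma rinner_commute: "rinner a b = rinner b a"
  unfolding rinner_def by (simp add: inner_commute)

lemma rinner_self: "rinner a a = (l2norm a)\<^sup>2"
  unfolding rinner_def l2norm_squared by (simp add: power2_norm_eq_inner)

lemma rinner_add_left:
  "in_L2per a \<Longrightarrow> in_L2per a' \<Longrightarrow> in_L2per b \<Longrightarrow> rinner (\<lambda>k. a k + a' k) b = rinner a b + rinner a' b"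
  unfolding rinner_def by (simp add: inner_add_left infsum_add rinner_summable)

lemma rinner_uminus_left: "rinner (\<lambda>k. - a k) b = - rinner a b"
  unfolding rinner_def by (simp add: infsum_uminus)

lemma rinner_diff_left:
  "in_L2per a \<Longrightarrow> in_L2per a' \<Longrightarrow> in_L2per b \<Longrightarrow> rinner (\<lambda>k. a k - a' k) b = rinner a b - rinner a' b"
  using rinner_add_left[of a "\<lambda>k. - a' k" b] in_L2per_uminus[of a'] by (simp add: rinner_uminus_left)

lemma rinner_diff_right:
  "in_L2per a \<Longrightarrow> in_L2per b \<Longrightarrow> in_L2per b' \<Longrightarrow> rinner a (\<lambda>k. b k - b' k) = rinner a b - rinner a b'"
  using rinner_diff_left[of b b' a] by (simp add: rinner_commute)

lemma rinner_scale_left: "rinner (\<lambda>k. complex_of_real r * a k) b = r * rinner a b"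
  unfolding rinner_def by (simp add: infsum_cmult_right' flip: scaleR_conv_of_real)

lemma rinner_scale_right: "rinner a (\<lambda>k. complex_of_real r * b k) = r * rinner a b"
  using rinner_scale_left[of r b a] by (simp add: rinner_commute)

lemma rinner_i_self: "rinner a (\<lambda>k. \<i> * a k) = 0"
  unfolding rinner_def by (simp add: inner_complex_def mult.commute)

lemma star_star [simp]: "star (star c) = c"
  unfolding star_def by simp

lemma bij_uminus_int: "bij (uminus :: int \<Rightarrow> int)"
  by (rule bij_uminus)

lemma in_L2per_star [simp]: "in_L2per (star c) = in_L2per c"
  unfolding in_L2per_def star_def
  using summable_on_reindex_bij_betw[OF bij_uminus_int, of "\<lambda>k. (cmod (c k))\<^sup>2"] by simp

lemma l2norm_star [simp]: "l2norm (star c) = l2norm c"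
  unfolding l2norm_def star_def
  using infsum_reindex_bij_betw[OF bij_uminus_int, of "\<lambda>k. (cmod (c k))\<^sup>2"] by simp

lemma in_l1_star [simp]: "in_l1 (star c) = in_l1 c"
  unfolding in_l1_def star_def
  using summable_on_reindex_bij_betw[OF bij_uminus_int, of "\<lambda>k. cmod (c k)"] by simp

lemma l1norm_star [simp]: "l1norm (star c) = l1norm c"
  unfolding l1norm_def star_def
  using infsum_reindex_bij_betw[OF bij_uminus_int, of "\<lambda>k. cmod (c k)"] by simp

lemma star_diff: "star (\<lambda>k. a k - b k) = (\<lambda>k. star a k - star b k)"
  unfolding star_def by simp

text \<open>The fourth index is forced: the mean over a period of a product of exponentials vanishes
  unless the frequencies add up to zero.\<close>

definition qterm :: "fcoef \<Rightarrow> fcoef \<Rightarrow> fcoef \<Rightarrow> fcoef \<Rightarrow> (int \<times> int) \<times> int \<Rightarrow> complex" where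
  "qterm a b c d = (\<lambda>((i, j), k). a i * b j * c k * d (- i - j - k))"

definition qsummable :: "fcoef \<Rightarrow> fcoef \<Rightarrow> fcoef \<Rightarrow> fcoef \<Rightarrow> bool" where
  "qsummable a b c d \<longleftrightarrow> (\<lambda>x. norm (qterm a b c d x)) summable_on UNIV"

text \<open>Up to the factor L this is \<integral> a b c d, hence symmetric in its four arguments.\<close>

definition qform :: "fcoef \<Rightarrow> fcoef \<Rightarrow> fcoef \<Rightarrow> fcoef \<Rightarrow> complex" where
  "qform a b c d = infsum (qterm a b c d) UNIV"

text \<open>For fixed i and j the sum over k pairs c with a reflected translate of d, so
  Cauchy-Schwarz bounds it independently of i and j; the remaining double sum factorises into two l1
  norms. This mirrors estimating two factors in the sup norm and two in L2.\<close>

lemma qform_summable_bound: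
  assumes "in_l1 a" "in_l1 b" "in_L2per c" "in_L2per d"
  shows "qsummable a b c d" "cmod (qform a b c d) \<le> l1norm a * l1norm b * l2norm c * l2norm d"
proof -
  define g where "g = (\<lambda>(i, j). \<Sum>\<^sub>\<infinity>k. norm (qterm a b c d ((i, j), k)))"
  have bij: "bij (\<lambda>k::int. - i - j - k)" for i j
    by (rule bij_betwI[of _ _ _ "\<lambda>k. - i - j - k"]) auto
  have sh: "in_L2per (\<lambda>k. d (- i - j - k))" "l2norm (\<lambda>k. d (- i - j - k)) = l2norm d" for i j
    using assms(4) summable_on_reindex_bij_betw[OF bij, of "\<lambda>k. (cmod (d k))\<^sup>2" i j]
      infsum_reindex_bij_betw[OF bij, of "\<lambda>k. (cmod (d k))\<^sup>2" i j]
    unfolding in_L2per_def l2norm_def by simp_all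
  have eq: "norm (qterm a b c d ((i, j), k)) = (cmod (a i) * cmod (b j)) * cmod (c k * d (- i - j - k))" for i j k
    by (simp add: qterm_def norm_mult)
  have s1: "(\<lambda>k. norm (qterm a b c d ((i, j), k))) summable_on UNIV" for i j
    unfolding eq using cauchy_schwarz_summable[OF assms(3) sh(1)[of i j]]
    by (intro summable_on_cmult_right) (simp add: in_l1_def)
  have g0: "0 \<le> g p" for p unfolding g_def by (auto intro: infsum_nonneg split: prod.split)
  have gle: "g p \<le> (\<lambda>(i, j). cmod (a i) * cmod (b j)) p * (l2norm c * l2norm d)" for p
  proof (cases p)
    case (Pair i j)
    have "g p = (cmod (a i) * cmod (b j)) * l1norm (\<lambda>k. c k * d (- i - j - k))"
      unfolding g_def Pair eq l1norm_def by (simp add: infsum_cmult_right')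
    also have "\<dots> \<le> (cmod (a i) * cmod (b j)) * (l2norm c * l2norm d)"
      using cauchy_schwarz[OF assms(3) sh(1)[of i j]] sh(2)[of i j] by (intro mult_left_mono) auto
    finally show ?thesis by (simp add: Pair)
  qed
  have ab: "(\<lambda>(i, j). cmod (a i) * cmod (b j)) summable_on UNIV"
    using assms(1,2) unfolding in_l1_def UNIV_Times_UNIV[symmetric]
    by (intro summable_on_SigmaI[where g = "\<lambda>i. cmod (a i) * l1norm b"])
       (auto simp: l1norm_def intro!: has_sum_cmult_right has_sum_infsum summable_on_cmult_left)
  have ab2: "infsum (\<lambda>(i, j). cmod (a i) * cmod (b j)) UNIV = l1norm a * l1norm b"
    using infsum_Sigma_banach[of "\<lambda>(i, j). cmod (a i) * cmod (b j)" UNIV "\<lambda>_. UNIV"] ab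
    by (simp add: l1norm_def infsum_cmult_right' infsum_cmult_left')
  have ab3: "(\<lambda>p. (\<lambda>(i, j). cmod (a i) * cmod (b j)) p * (l2norm c * l2norm d)) summable_on UNIV"
    by (rule summable_on_cmult_left[OF ab])
  have gs: "g summable_on UNIV"
    by (rule summable_on_comparison_test[OF ab3 gle g0])
  have "(\<lambda>x. norm (qterm a b c d x)) summable_on UNIV \<times> UNIV"
    unfolding Infinite_Sum.abs_summable_on_Sigma_iff
  proof (intro conjI ballI)
    fix p show "(\<lambda>y. norm (qterm a b c d (p, y))) summable_on UNIV"
      using s1 by (cases p) auto
  next
    have "(\<lambda>x. \<Sum>\<^sub>\<infinity>y. norm (qterm a b c d (x, y))) = g"
      by (auto simp: g_def)
    with gs show "(\<lambda>x. norm (\<Sum>\<^sub>\<infinity>y. norm (qterm a b c d (x, y)))) summable_on UNIV"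
      by (simp add: abs_of_nonneg infsum_nonneg)
  qed
  then have abs: "(\<lambda>x. norm (qterm a b c d x)) summable_on UNIV" by simp
  then show "qsummable a b c d" by (simp add: qsummable_def)
  have "cmod (qform a b c d) \<le> infsum (\<lambda>x. norm (qterm a b c d x)) UNIV"
    unfolding qform_def by (rule norm_infsum_bound) (rule abs)
  also have "\<dots> = infsum g UNIV"
    using infsum_Sigma_banach[of "\<lambda>x. norm (qterm a b c d x)" UNIV "\<lambda>_. UNIV"] abs
    by (simp add: g_def case_prod_beta')
  also have "\<dots> \<le> infsum (\<lambda>p. (\<lambda>(i, j). cmod (a i) * cmod (b j)) p * (l2norm c * l2norm d)) UNIV"
    by (rule infsum_mono[OF gs ab3 gle])
  also have "\<dots> = l1norm a * l1norm b * l2norm c * l2norm d"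
    by (simp add: infsum_cmult_left' ab2)
  finally show "cmod (qform a b c d) \<le> l1norm a * l1norm b * l2norm c * l2norm d" .
qed

lemma qform_swap12: "qform b a c d = qform a b c d"
  and qsummable_swap12: "qsummable b a c d = qsummable a b c d"
proof -
  let ?g = "\<lambda>((i, j), k). ((j, i), k) :: (int \<times> int) \<times> int"
  have bij: "bij ?g" by (rule bij_betwI[of _ _ _ ?g]) auto
  have eq: "qterm b a c d = (\<lambda>x. qterm a b c d (?g x))"
  proof
    fix x :: "(int \<times> int) \<times> int"
    obtain i j k where x: "x = ((i, j), k)" by (metis surj_pair)
    have "- j - i - k = - i - j - k" by simp
    then show "qterm b a c d x = qterm a b c d (?g x)"
      by (simp only: x qterm_def prod.case mult_ac)
  qed
  show "qform b a c d = qform a b c d" unfolding qform_def eq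
    using infsum_reindex_bij_betw[OF bij] by blast
  show "qsummable b a c d = qsummable a b c d" unfolding qsummable_def eq
    using summable_on_reindex_bij_betw[OF bij, of "\<lambda>x. norm (qterm a b c d x)"] by blast
qed

lemma qform_swap23: "qform a c b d = qform a b c d"
  and qsummable_swap23: "qsummable a c b d = qsummable a b c d"
proof -
  let ?g = "\<lambda>((i, j), k). ((i, k), j) :: (int \<times> int) \<times> int"
  have bij: "bij ?g" by (rule bij_betwI[of _ _ _ ?g]) auto
  have eq: "qterm a c b d = (\<lambda>x. qterm a b c d (?g x))"
  proof
    fix x :: "(int \<times> int) \<times> int"
    obtain i j k where x: "x = ((i, j), k)" by (metis surj_pair)
    have "- i - k - j = - i - j - k" by simp
    then show "qterm a c b d x = qterm a b c d (?g x)"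
      by (simp only: x qterm_def prod.case mult_ac)
  qed
  show "qform a c b d = qform a b c d" unfolding qform_def eq
    using infsum_reindex_bij_betw[OF bij] by blast
  show "qsummable a c b d = qsummable a b c d" unfolding qsummable_def eq
    using summable_on_reindex_bij_betw[OF bij, of "\<lambda>x. norm (qterm a b c d x)"] by blast
qed

text \<open>Taking the dependent index as the new summation index exchanges the last two slots. With
  the two swaps above, these adjacent transpositions generate all permutations of the
  arguments.\<close>

lemma qform_swap34: "qform a b d c = qform a b c d"
  and qsummable_swap34: "qsummable a b d c = qsummable a b c d"
proof -
  let ?g = "\<lambda>((i, j), k). ((i, j), - i - j - k) :: (int \<times> int) \<times> int"
  have bij: "bij ?g" by (rule bij_betwI[of _ _ _ ?g]) auto
  have eq: "qterm a b d c = (\<lambda>x. qterm a b c d (?g x))"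
  proof
    fix x :: "(int \<times> int) \<times> int"
    obtain i j k where x: "x = ((i, j), k)" by (metis surj_pair)
    have "- i - j - (- i - j - k) = k" by simp
    then show "qterm a b d c x = qterm a b c d (?g x)"
      by (simp only: x qterm_def prod.case mult_ac)
  qed
  show "qform a b d c = qform a b c d" unfolding qform_def eq
    using infsum_reindex_bij_betw[OF bij] by blast
  show "qsummable a b d c = qsummable a b c d" unfolding qsummable_def eq
    using summable_on_reindex_bij_betw[OF bij, of "\<lambda>x. norm (qterm a b c d x)"] by blast
qed

lemma qform_add1:
  assumes "qsummable a b c d" "qsummable a' b c d"
  shows "qform (\<lambda>k. a k + a' k) b c d = qform a b c d + qform a' b c d"
proof -
  have "qterm (\<lambda>k. a k + a' k) b c d = (\<lambda>x. qterm a b c d x + qterm a' b c d x)"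
    by (auto simp: qterm_def fun_eq_iff algebra_simps)
  then show ?thesis using assms unfolding qform_def qsummable_def
    by (simp add: infsum_add Infinite_Sum.abs_summable_summable)
qed

lemma qform_uminus1: "qform (\<lambda>k. - a k) b c d = - qform a b c d"
  and qsummable_uminus1: "qsummable (\<lambda>k. - a k) b c d = qsummable a b c d"
proof -
  have eq: "qterm (\<lambda>k. - a k) b c d = (\<lambda>x. - qterm a b c d x)"
    by (auto simp: qterm_def fun_eq_iff)
  show "qform (\<lambda>k. - a k) b c d = - qform a b c d"
    unfolding qform_def eq by (rule infsum_uminus)
  show "qsummable (\<lambda>k. - a k) b c d = qsummable a b c d"
    unfolding qsummable_def eq by simp
qed

lemma qform_diff1:
  assumes "qsummable a b c d" "qsummable a' b c d"
  shows "qform (\<lambda>k. a k - a' k) b c d = qform a b c d - qform a' b c d"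
  using qform_add1[of a b c d "\<lambda>k. - a' k"] assms
  by (simp add: qform_uminus1 qsummable_uminus1)

lemma qform_diff2:
  assumes "qsummable a b c d" "qsummable a b' c d"
  shows "qform a (\<lambda>k. b k - b' k) c d = qform a b c d - qform a b' c d"
  using qform_diff1[of b a c d b'] assms by (simp add: qform_swap12 qsummable_swap12)

lemma qform_diff3:
  assumes "qsummable a b c d" "qsummable a b c' d"
  shows "qform a b (\<lambda>k. c k - c' k) d = qform a b c d - qform a b c' d"
  using qform_diff2[of a c b d c'] assms
  by (simp add: qform_swap23[of a _ b d] qsummable_swap23[of a _ b d])

lemma qform_diff4:
  assumes "qsummable a b c d" "qsummable a b c d'"
  shows "qform a b c (\<lambda>k. d k - d' k) = qform a b c d - qform a b c d'"
  using qform_diff3[of a b d c d'] assms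
  by (simp add: qform_swap34[of a b _ c] qsummable_swap34[of a b _ c])

lemma qform_scale1: "qform (\<lambda>k. z * a k) b c d = z * qform a b c d"
proof -
  have "qterm (\<lambda>k. z * a k) b c d = (\<lambda>x. z * qterm a b c d x)"
    by (auto simp: qterm_def fun_eq_iff algebra_simps)
  then show ?thesis unfolding qform_def by (simp add: infsum_cmult_right')
qed

lemma qform_star: "qform (star a) (star b) (star c) (star d) = cnj (qform a b c d)"
proof -
  let ?g = "\<lambda>((i, j), k). ((- i, - j), - k) :: (int \<times> int) \<times> int"
  have bij: "bij ?g" by (rule bij_betwI[of _ _ _ ?g]) auto
  have eq: "qterm (star a) (star b) (star c) (star d) = (\<lambda>x. cnj (qterm a b c d (?g x)))"
    by (auto simp: qterm_def star_def fun_eq_iff algebra_simps)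
  show ?thesis unfolding qform_def eq
    using infsum_reindex_bij_betw[OF bij, of "qterm a b c d"] by simp
qed

section \<open>Calculus along paths of sequences\<close>

lemma l2norm_mono:
  assumes "in_L2per b" "\<And>k. cmod (a k) \<le> cmod (b k)"
  shows "in_L2per a" "l2norm a \<le> l2norm b"
proof -
  have *: "L2_set (\<lambda>k. cmod (a k)) S \<le> l2norm b" if "finite S" for S
    using L2_set_mono[of S "\<lambda>k. cmod (a k)" "\<lambda>k. cmod (b k)"] assms L2_set_le_l2norm[OF assms(1) that]
    by force
  show "in_L2per a" by (rule l2norm_bound(1)) (rule *)
  show "l2norm a \<le> l2norm b" by (rule l2norm_bound(2)) (rule *)
qed

lemma coeff_le_l2norm: "in_L2per c \<Longrightarrow> cmod (c k) \<le> l2norm c"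
  using L2_set_le_l2norm[of c "{k}"] by simp

lemma l2norm_eq_0: "in_L2per c \<Longrightarrow> l2norm c = 0 \<Longrightarrow> c k = 0"
  using coeff_le_l2norm[of c k] by simp

lemma in_L2per_zero [simp]: "in_L2per (\<lambda>k. 0)"
  unfolding in_L2per_def by simp

lemma qform_rot3: "qform a b x d = qform x a b d"
  by (metis qform_swap12 qform_swap23)

lemma qform_rot4: "qform a b c x = qform x a b c"
  by (metis qform_swap12 qform_swap23 qform_swap34)

lemma qsummable_rot3: "qsummable a b x d = qsummable x a b d"
  by (metis qsummable_swap12 qsummable_swap23)

lemma qsummable_rot4: "qsummable a b c x = qsummable x a b c"
  by (metis qsummable_swap12 qsummable_swap23 qsummable_swap34)

lemma qform_bound12:
  assumes "in_L2per a" "in_L2per b" "in_l1 c" "in_l1 d"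
  shows "cmod (qform a b c d) \<le> l2norm a * l2norm b * l1norm c * l1norm d"
proof -
  have "qform a b c d = qform c d a b"
    by (metis qform_rot4)
  then show ?thesis using qform_summable_bound(2)[of c d a b] assms by (simp add: mult_ac)
qed

lemma qform_bound13:
  assumes "in_L2per a" "in_l1 b" "in_L2per c" "in_l1 d"
  shows "cmod (qform a b c d) \<le> l2norm a * l1norm b * l2norm c * l1norm d"
  using qform_bound12[of a c b d] assms by (simp add: qform_swap23[of a b] mult_ac)

lemma qform_bound14:
  assumes "in_L2per a" "in_l1 b" "in_l1 c" "in_L2per d"
  shows "cmod (qform a b c d) \<le> l2norm a * l1norm b * l1norm c * l2norm d"
  using qform_bound13[of a b d c] assms by (simp add: qform_swap34[of a b c] mult_ac)

lemma qsummable1: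
  assumes "in_L2per a" "in_l1 b" "in_l1 c" "in_l1 d"
  shows "qsummable a b c d"
proof -
  have "qsummable a b c d = qsummable b c a d"
    by (metis qsummable_rot3)
  then show ?thesis using qform_summable_bound(1)[of b c a d] assms by (simp add: in_l1_imp_L2per)
qed

lemma qsummable4: "in_l1 a \<Longrightarrow> in_l1 b \<Longrightarrow> in_l1 c \<Longrightarrow> in_L2per d \<Longrightarrow> qsummable a b c d"
  by (metis qsummable1 qsummable_rot4)

lemma qform_bound1:
  assumes "in_L2per a" "in_l1 b" "in_l1 c" "in_l1 d"
  shows "cmod (qform a b c d) \<le> l2norm a * l1norm b * l1norm c * l1norm d"
proof -
  have "cmod (qform a b c d) \<le> l2norm a * l2norm b * l1norm c * l1norm d"
    using assms by (simp add: qform_bound12 in_l1_imp_L2per)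
  also have "\<dots> \<le> l2norm a * l1norm b * l1norm c * l1norm d"
    using assms by (intro mult_right_mono mult_left_mono l2norm_le_l1norm) auto
  finally show ?thesis .
qed

text \<open>Telescoping, one argument at a time. The first slot is meant for difference quotients in
  time, whose limit is known only in l2; the other three compensate by converging in l1.\<close>

lemma qform_tendsto:
  assumes a: "in_L2per a" "\<And>h. in_L2per (A h)" "((\<lambda>h. l2norm (\<lambda>k. A h k - a k)) \<longlongrightarrow> 0) G"
    and b: "in_l1 b" "\<And>h. in_l1 (B h)" "((\<lambda>h. l1norm (\<lambda>k. B h k - b k)) \<longlongrightarrow> 0) G"
    and c: "in_l1 c" "\<And>h. in_l1 (C h)" "((\<lambda>h. l1norm (\<lambda>k. C h k - c k)) \<longlongrightarrow> 0) G"
    and d: "in_l1 d" "\<And>h. in_l1 (E h)" "((\<lambda>h. l1norm (\<lambda>k. E h k - d k)) \<longlongrightarrow> 0) G"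
  shows "((\<lambda>h. qform (A h) (B h) (C h) (E h)) \<longlongrightarrow> qform a b c d) G"
proof -
  define \<alpha> \<beta> \<eta> \<delta> where "\<alpha> h = l2norm (\<lambda>k. A h k - a k)" and "\<beta> h = l1norm (\<lambda>k. B h k - b k)"
    and "\<eta> h = l1norm (\<lambda>k. C h k - c k)" and "\<delta> h = l1norm (\<lambda>k. E h k - d k)" for h
  define R where "R h = \<alpha> h * (l1norm b + \<beta> h) * (l1norm c + \<eta> h) * (l1norm d + \<delta> h)
      + l2norm a * \<beta> h * (l1norm c + \<eta> h) * (l1norm d + \<delta> h)
      + l2norm a * l1norm b * \<eta> h * (l1norm d + \<delta> h) + l2norm a * l1norm b * l1norm c * \<delta> h" for h
  have t: "(\<alpha> \<longlongrightarrow> 0) G" "(\<beta> \<longlongrightarrow> 0) G" "(\<eta> \<longlongrightarrow> 0) G" "(\<delta> \<longlongrightarrow> 0) G"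
    unfolding \<alpha>_def \<beta>_def \<eta>_def \<delta>_def by (fact a b c d)+
  have "(R \<longlongrightarrow> 0 * (l1norm b + 0) * (l1norm c + 0) * (l1norm d + 0) + l2norm a * 0 * (l1norm c + 0) * (l1norm d + 0)
      + l2norm a * l1norm b * 0 * (l1norm d + 0) + l2norm a * l1norm b * l1norm c * 0) G"
    unfolding R_def by (intro tendsto_intros t)
  then have R0: "(R \<longlongrightarrow> 0) G" by simp
  have "norm (qform (A h) (B h) (C h) (E h) - qform a b c d) \<le> R h" for h
  proof -
    have s: "in_L2per (\<lambda>k. A h k - a k)" "in_l1 (\<lambda>k. B h k - b k)" "in_l1 (\<lambda>k. C h k - c k)"
      "in_l1 (\<lambda>k. E h k - d k)"
      using a b c d by (auto intro: in_L2per_diff in_l1_diff)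
    have B: "l1norm (B h) \<le> l1norm b + \<beta> h" "l1norm (C h) \<le> l1norm c + \<eta> h" "l1norm (E h) \<le> l1norm d + \<delta> h"
      unfolding \<beta>_def \<eta>_def \<delta>_def using b c d by (auto intro: l1norm_triangle_sub)
    have nn: "0 \<le> \<alpha> h" "0 \<le> \<beta> h" "0 \<le> \<eta> h" "0 \<le> \<delta> h"
      unfolding \<alpha>_def \<beta>_def \<eta>_def \<delta>_def by auto
    have eq: "qform (A h) (B h) (C h) (E h) - qform a b c d =
        qform (\<lambda>k. A h k - a k) (B h) (C h) (E h) + qform a (\<lambda>k. B h k - b k) (C h) (E h)
        + qform a b (\<lambda>k. C h k - c k) (E h) + qform a b c (\<lambda>k. E h k - d k)"
      using a b c d by (simp add: qform_diff1 qform_diff2 qform_diff3 qform_diff4 qsummable1)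
    have "norm (qform (A h) (B h) (C h) (E h) - qform a b c d) \<le> cmod (qform (\<lambda>k. A h k - a k) (B h) (C h) (E h))
        + cmod (qform a (\<lambda>k. B h k - b k) (C h) (E h))
        + cmod (qform a b (\<lambda>k. C h k - c k) (E h)) + cmod (qform a b c (\<lambda>k. E h k - d k))"
      unfolding eq by (intro norm_triangle_mono order_refl)
    also have "\<dots> \<le> \<alpha> h * l1norm (B h) * l1norm (C h) * l1norm (E h) + l2norm a * \<beta> h * l1norm (C h) * l1norm (E h)
        + l2norm a * l1norm b * \<eta> h * l1norm (E h) + l2norm a * l1norm b * l1norm c * \<delta> h"
      unfolding \<alpha>_def \<beta>_def \<eta>_def \<delta>_def using a b c d s by (intro add_mono qform_bound1) auto
    also have "\<dots> \<le> R h"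
      unfolding R_def using B nn by (intro add_mono mult_mono) auto
    finally show ?thesis .
  qed
  then have "((\<lambda>h. qform (A h) (B h) (C h) (E h) - qform a b c d) \<longlongrightarrow> 0) G"
    by (intro Lim_null_comparison[OF _ R0]) auto
  then show ?thesis by (simp add: LIM_zero_iff)
qed

lemma rinner_tendsto:
  assumes a: "in_L2per a" "\<And>h. in_L2per (A h)" "((\<lambda>h. l2norm (\<lambda>k. A h k - a k)) \<longlongrightarrow> 0) G"
    and b: "in_L2per b" "\<And>h. in_L2per (B h)" "((\<lambda>h. l2norm (\<lambda>k. B h k - b k)) \<longlongrightarrow> 0) G"
  shows "((\<lambda>h. rinner (A h) (B h)) \<longlongrightarrow> rinner a b) G"
proof -
  define \<alpha> \<beta> where "\<alpha> h = l2norm (\<lambda>k. A h k - a k)" and "\<beta> h = l2norm (\<lambda>k. B h k - b k)" for h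
  define R where "R h = \<alpha> h * (l2norm b + \<beta> h) + l2norm a * \<beta> h" for h
  have t: "(\<alpha> \<longlongrightarrow> 0) G" "(\<beta> \<longlongrightarrow> 0) G"
    unfolding \<alpha>_def \<beta>_def by (fact a b)+
  have "(R \<longlongrightarrow> 0 * (l2norm b + 0) + l2norm a * 0) G"
    unfolding R_def by (intro tendsto_intros t)
  then have R0: "(R \<longlongrightarrow> 0) G" by simp
  have "norm (rinner (A h) (B h) - rinner a b) \<le> R h" for h
  proof -
    have s: "in_L2per (\<lambda>k. A h k - a k)" "in_L2per (\<lambda>k. B h k - b k)"
      using a b by (auto intro: in_L2per_diff)
    have B: "l2norm (B h) \<le> l2norm b + \<beta> h"
      unfolding \<beta>_def using b by (auto intro: l2norm_triangle_sub)
    have eq: "rinner (A h) (B h) - rinner a b = rinner (\<lambda>k. A h k - a k) (B h) + rinner a (\<lambda>k. B h k - b k)"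
      using a b by (simp add: rinner_diff_left rinner_diff_right)
    have "norm (rinner (A h) (B h) - rinner a b) \<le> \<bar>rinner (\<lambda>k. A h k - a k) (B h)\<bar> + \<bar>rinner a (\<lambda>k. B h k - b k)\<bar>"
      unfolding eq by simp
    also have "\<dots> \<le> \<alpha> h * l2norm (B h) + l2norm a * \<beta> h"
      unfolding \<alpha>_def \<beta>_def using a b s by (intro add_mono rinner_bound) auto
    also have "\<dots> \<le> R h"
      unfolding R_def using B by (intro add_mono mult_mono) (auto simp: \<alpha>_def \<beta>_def)
    finally show ?thesis .
  qed
  then have "((\<lambda>h. rinner (A h) (B h) - rinner a b) \<longlongrightarrow> 0) G"
    by (intro Lim_null_comparison[OF _ R0]) auto
  then show ?thesis by (simp add: LIM_zero_iff)
qed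

section \<open>Time continuity and differentiability in l1 and l2\<close>

definition l2_deriv :: "(real \<Rightarrow> fcoef) \<Rightarrow> fcoef \<Rightarrow> real \<Rightarrow> bool" where
  "l2_deriv a a' t \<longleftrightarrow> in_L2per a' \<and>
     ((\<lambda>h. l2norm (\<lambda>k. (a (t + h) k - a t k) / complex_of_real h - a' k)) \<longlongrightarrow> 0) (at 0)"

text \<open>Membership at every time is part of the notion: \<open>l1norm\<close> of a non-summable
  sequence is the default value 0, so the limit alone would say nothing.\<close>

definition l1_cont :: "(real \<Rightarrow> fcoef) \<Rightarrow> real \<Rightarrow> bool" where
  "l1_cont a t \<longleftrightarrow> (\<forall>s. in_l1 (a s)) \<and> ((\<lambda>h. l1norm (\<lambda>k. a (t + h) k - a t k)) \<longlongrightarrow> 0) (at 0)"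

definition l2_cont :: "(real \<Rightarrow> fcoef) \<Rightarrow> real \<Rightarrow> bool" where
  "l2_cont a t \<longleftrightarrow> (\<forall>s. in_L2per (a s)) \<and> ((\<lambda>h. l2norm (\<lambda>k. a (t + h) k - a t k)) \<longlongrightarrow> 0) (at 0)"

lemma l2_cont_const: "in_L2per a \<Longrightarrow> l2_cont (\<lambda>_. a) t"
  unfolding l2_cont_def by (simp add: l2norm_def)

lemma l2_deriv_const: "l2_deriv (\<lambda>_. a) (\<lambda>k. 0) t"
  unfolding l2_deriv_def by (simp add: l2norm_def)

lemma l1_cont_imp_l2_cont:
  assumes "l1_cont a t" shows "l2_cont a t"
proof -
  have s: "in_l1 (a s)" for s using assms by (simp add: l1_cont_def)
  have "((\<lambda>h. l2norm (\<lambda>k. a (t + h) k - a t k)) \<longlongrightarrow> 0) (at 0)"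
  proof (rule Lim_null_comparison)
    show "((\<lambda>h. l1norm (\<lambda>k. a (t + h) k - a t k)) \<longlongrightarrow> 0) (at 0)"
      using assms by (simp add: l1_cont_def)
  qed (simp add: l2norm_le_l1norm in_l1_diff s)
  then show ?thesis using s by (simp add: l2_cont_def in_l1_imp_L2per)
qed

lemma l1_cont_star: "l1_cont a t \<Longrightarrow> l1_cont (\<lambda>s. star (a s)) t"
  unfolding l1_cont_def by (simp flip: star_diff)

lemma l2_deriv_star: 
  assumes "l2_deriv a a' t" shows "l2_deriv (\<lambda>s. star (a s)) (star a') t"
proof -
  have "(\<lambda>k. (star (a (t + h)) k - star (a t) k) / complex_of_real h - star a' k) =
    star (\<lambda>k. (a (t + h) k - a t k) / complex_of_real h - a' k)" for h
    by (simp add: star_def)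
  then show ?thesis using assms unfolding l2_deriv_def by simp
qed

lemma l1_cont_diff:
  assumes "l1_cont a t" "l1_cont b t" shows "l1_cont (\<lambda>s k. a s k - b s k) t"
proof -
  have s: "in_l1 (a s)" "in_l1 (b s)" for s using assms by (auto simp: l1_cont_def)
  have "((\<lambda>h. l1norm (\<lambda>k. a (t + h) k - a t k) + l1norm (\<lambda>k. b (t + h) k - b t k)) \<longlongrightarrow> 0 + 0) (at 0)"
    using assms by (intro tendsto_add) (auto simp: l1_cont_def)
  then have lim: "((\<lambda>h. l1norm (\<lambda>k. a (t + h) k - a t k) + l1norm (\<lambda>k. b (t + h) k - b t k)) \<longlongrightarrow> 0) (at 0)"
    by simp
  have le: "l1norm (\<lambda>k. (a (t + h) k - b (t + h) k) - (a t k - b t k)) \<le>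
      l1norm (\<lambda>k. a (t + h) k - a t k) + l1norm (\<lambda>k. b (t + h) k - b t k)" for h
  proof -
    have "(\<lambda>k. (a (t + h) k - b (t + h) k) - (a t k - b t k)) =
      (\<lambda>k. (a (t + h) k - a t k) + - (b (t + h) k - b t k))" by (auto simp: algebra_simps)
    then show ?thesis
      using l1norm_triangle[of "\<lambda>k. a (t + h) k - a t k" "\<lambda>k. - (b (t + h) k - b t k)"] 
        l1norm_uminus[of "\<lambda>k. b (t + h) k - b t k"] in_l1_uminus[OF in_l1_diff[OF s(2) s(2)]]
      by (simp add: s in_l1_diff)
  qed
  have "((\<lambda>h. l1norm (\<lambda>k. (a (t + h) k - b (t + h) k) - (a t k - b t k))) \<longlongrightarrow> 0) (at 0)"
    by (rule Lim_null_comparison[OF _ lim]) (simp add: le)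
  then show ?thesis using s by (simp add: l1_cont_def in_l1_diff)
qed

lemma l2_deriv_diff:
  assumes "l2_deriv a a' t" "l2_deriv b b' t" "\<And>s. in_L2per (a s)" "\<And>s. in_L2per (b s)"
  shows "l2_deriv (\<lambda>s k. a s k - b s k) (\<lambda>k. a' k - b' k) t"
proof -
  define p where "p h = (\<lambda>k. (a (t + h) k - a t k) / complex_of_real h - a' k)" for h
  define q where "q h = (\<lambda>k. (b (t + h) k - b t k) / complex_of_real h - b' k)" for h
  have s': "in_L2per a'" "in_L2per b'" using assms by (auto simp: l2_deriv_def)
  have s: "in_L2per (p h)" "in_L2per (q h)" for h
    using in_L2per_diff[OF in_L2per_scale[OF in_L2per_diff[OF assms(3) assms(3)]] s'(1), of "1 / complex_of_real h"]
      in_L2per_diff[OF in_L2per_scale[OF in_L2per_diff[OF assms(4) assms(4)]] s'(2), of "1 / complex_of_real h"]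
    unfolding p_def q_def by simp_all
  have "((\<lambda>h. l2norm (p h) + l2norm (q h)) \<longlongrightarrow> 0 + 0) (at 0)"
    using assms unfolding p_def q_def by (intro tendsto_add) (auto simp: l2_deriv_def)
  then have lim: "((\<lambda>h. l2norm (p h) + l2norm (q h)) \<longlongrightarrow> 0) (at 0)" by simp
  have eq: "(\<lambda>k. ((a (t + h) k - b (t + h) k) - (a t k - b t k)) / complex_of_real h - (a' k - b' k)) =
      (\<lambda>k. p h k - q h k)" for h
    unfolding p_def q_def by (simp add: algebra_simps diff_divide_distrib add_divide_distrib)
  have "((\<lambda>h. l2norm (\<lambda>k. p h k - q h k)) \<longlongrightarrow> 0) (at 0)"
    by (rule Lim_null_comparison[OF _ lim]) (simp add: l2norm_triangle_diff s)
  then show ?thesis using s' unfolding l2_deriv_def eq by (auto intro: in_L2per_diff)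
qed

lemma qform_quotient1:
  assumes "in_l1 A" "in_l1 A'" "in_l1 b" "in_l1 c" "in_l1 d"
  shows "qform (\<lambda>k. (A k - A' k) / z) b c d = (qform A b c d - qform A' b c d) / z"
  using qform_scale1[of "1 / z" "\<lambda>k. A k - A' k" b c d] assms
  by (simp add: qform_diff1 qsummable1 in_l1_imp_L2per)

lemma qform_deriv:
  assumes "l1_cont a t" "l1_cont b t" "l1_cont c t" "l1_cont d t"
    and "l2_deriv a a' t" "l2_deriv b b' t" "l2_deriv c c' t" "l2_deriv d d' t"
  shows "((\<lambda>s. Re (qform (a s) (b s) (c s) (d s))) has_real_derivative
    Re (qform a' (b t) (c t) (d t)) + Re (qform (a t) b' (c t) (d t)) +
    Re (qform (a t) (b t) c' (d t)) + Re (qform (a t) (b t) (c t) d')) (at t)"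
proof -
  have s: "in_l1 (a r)" "in_l1 (b r)" "in_l1 (c r)" "in_l1 (d r)" for r
    using assms by (auto simp: l1_cont_def)
  have s': "in_L2per a'" "in_L2per b'" "in_L2per c'" "in_L2per d'"
    using assms by (auto simp: l2_deriv_def)
  let ?\<Delta> = "\<lambda>(f :: real \<Rightarrow> fcoef) h k. (f (t + h) k - f t k) / complex_of_real h"
  have d: "in_L2per (?\<Delta> f h)" if "\<And>r. in_l1 (f r)" for f h
    using in_L2per_scale[OF in_L2per_diff, of "f (t + h)" "f t" "1 / complex_of_real h"] that
    by (simp add: in_l1_imp_L2per)
  have z: "((\<lambda>h. l1norm (\<lambda>k. f t k - f t k)) \<longlongrightarrow> 0) (at (0::real))" for f :: "real \<Rightarrow> fcoef"
    by (simp add: l1norm_def)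
  have eq: "(qform (a (t + h)) (b (t + h)) (c (t + h)) (d (t + h)) - qform (a t) (b t) (c t) (d t)) / complex_of_real h =
    qform (?\<Delta> a h) (b (t + h)) (c (t + h)) (d (t + h)) + qform (a t) (?\<Delta> b h) (c (t + h)) (d (t + h))
    + qform (a t) (b t) (?\<Delta> c h) (d (t + h)) + qform (a t) (b t) (c t) (?\<Delta> d h)" for h
  proof -
    let ?a = "a (t + h)" and ?b = "b (t + h)" and ?c = "c (t + h)" and ?d = "d (t + h)"
    have "qform (?\<Delta> a h) ?b ?c ?d = (qform ?a ?b ?c ?d - qform (a t) ?b ?c ?d) / complex_of_real h"
      by (intro qform_quotient1 s)
    moreover have "qform (a t) (?\<Delta> b h) ?c ?d = (qform (a t) ?b ?c ?d - qform (a t) (b t) ?c ?d) / complex_of_real h"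
      unfolding qform_swap12[of "a t"] by (intro qform_quotient1 s)
    moreover have "qform (a t) (b t) (?\<Delta> c h) ?d = (qform (a t) (b t) ?c ?d - qform (a t) (b t) (c t) ?d) / complex_of_real h"
      unfolding qform_rot3[of "a t" "b t"] by (intro qform_quotient1 s)
    moreover have "qform (a t) (b t) (c t) (?\<Delta> d h) = (qform (a t) (b t) (c t) ?d - qform (a t) (b t) (c t) (d t)) / complex_of_real h"
      unfolding qform_rot4[of "a t" "b t"] by (intro qform_quotient1 s)
    ultimately show ?thesis by (simp flip: add_divide_distrib)
  qed
  \<comment> \<open>Each telescoped summand contains one difference quotient, convergent only in l2.
    Symmetry brings it to the first slot, the one where \<open>qform_tendsto\<close> asks for no
    more than that.\<close>
  have "((\<lambda>h. qform (?\<Delta> a h) (b (t + h)) (c (t + h)) (d (t + h)) + qform (a t) (?\<Delta> b h) (c (t + h)) (d (t + h))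
    + qform (a t) (b t) (?\<Delta> c h) (d (t + h)) + qform (a t) (b t) (c t) (?\<Delta> d h)) \<longlongrightarrow>
    qform a' (b t) (c t) (d t) + qform (a t) b' (c t) (d t) +
    qform (a t) (b t) c' (d t) + qform (a t) (b t) (c t) d') (at 0)"
    unfolding qform_swap12[of "a t" "?\<Delta> b _"] qform_rot3[of _ _ "?\<Delta> c _"] qform_rot4[of _ _ _ "?\<Delta> d _"]
      qform_swap12[of "a t" b'] qform_rot3[of _ _ c'] qform_rot4[of _ _ _ d']
    using assms
    by (intro tendsto_add qform_tendsto s s' d z) (auto simp: l1_cont_def l2_deriv_def)
  then have "((\<lambda>h. Re ((qform (a (t + h)) (b (t + h)) (c (t + h)) (d (t + h)) - qform (a t) (b t) (c t) (d t)) / complex_of_real h)) \<longlongrightarrow>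
    Re (qform a' (b t) (c t) (d t) + qform (a t) b' (c t) (d t) +
    qform (a t) (b t) c' (d t) + qform (a t) (b t) (c t) d')) (at 0)"
    unfolding eq[symmetric] by (rule tendsto_Re)
  then show ?thesis unfolding DERIV_def by simp
qed

lemma rinner_quotient:
  assumes "in_L2per A" "in_L2per A'" "in_L2per b"
  shows "rinner (\<lambda>k. (A k - A' k) / complex_of_real r) b = (rinner A b - rinner A' b) / r"
  using rinner_scale_left[of "1 / r" "\<lambda>k. A k - A' k" b] assms
  by (simp add: rinner_diff_left)

lemma rinner_deriv:
  assumes "l2_cont a t" "l2_cont b t" "l2_deriv a a' t" "l2_deriv b b' t"
  shows "((\<lambda>s. rinner (a s) (b s)) has_real_derivative rinner a' (b t) + rinner (a t) b') (at t)"
proof -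
  have s: "in_L2per (a r)" "in_L2per (b r)" for r
    using assms by (auto simp: l2_cont_def)
  have s': "in_L2per a'" "in_L2per b'"
    using assms by (auto simp: l2_deriv_def)
  let ?\<Delta> = "\<lambda>(f :: real \<Rightarrow> fcoef) h k. (f (t + h) k - f t k) / complex_of_real h"
  have d: "in_L2per (?\<Delta> f h)" if "\<And>r. in_L2per (f r)" for f h
    using in_L2per_scale[OF in_L2per_diff, of "f (t + h)" "f t" "1 / complex_of_real h"] that
    by simp
  have z: "((\<lambda>h. l2norm (\<lambda>k. f t k - f t k)) \<longlongrightarrow> 0) (at (0::real))" for f :: "real \<Rightarrow> fcoef"
    by (simp add: l2norm_def)
  have eq: "(rinner (a (t + h)) (b (t + h)) - rinner (a t) (b t)) / h =
    rinner (?\<Delta> a h) (b (t + h)) + rinner (a t) (?\<Delta> b h)" for h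
  proof -
    have "rinner (?\<Delta> a h) (b (t + h)) = (rinner (a (t + h)) (b (t + h)) - rinner (a t) (b (t + h))) / h"
      by (intro rinner_quotient s)
    moreover have "rinner (a t) (?\<Delta> b h) = (rinner (a t) (b (t + h)) - rinner (a t) (b t)) / h"
      unfolding rinner_commute[of "a t"] by (intro rinner_quotient s)
    ultimately show ?thesis by (simp flip: add_divide_distrib)
  qed
  have "((\<lambda>h. rinner (?\<Delta> a h) (b (t + h)) + rinner (a t) (?\<Delta> b h)) \<longlongrightarrow> rinner a' (b t) + rinner (a t) b') (at 0)"
    using assms
    by (intro tendsto_add rinner_tendsto s s' d z) (auto simp: l2_cont_def l2_deriv_def)
  then show ?thesis unfolding DERIV_def eq .
qed

text \<open>Reindexing by the output frequency k turns the sum over frequencies adding up to zero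
  into the convolution \<open>cubic\<close> paired with z. Three l1 arguments make the sum
  absolutely convergent, which justifies summing over pairs first.\<close>

lemma qform_cubic:
  assumes "in_l1 u" "in_L2per z"
  shows "rinner (cubic u) z = Re (qform u u (star u) (star z))"
proof -
  define g :: "int \<times> int \<times> int \<Rightarrow> (int \<times> int) \<times> int" where "g = (\<lambda>(k, (i, j)). ((i, j), k - i - j))"
  have bij: "bij g" unfolding g_def
    by (rule bij_betwI[of _ _ _ "\<lambda>((i, j), l). (l + i + j, (i, j))"]) auto
  define T where "T = qterm u u (star u) (star z)"
  define h where "h = (\<lambda>(k, p). (\<lambda>(i, j). u i * u j * cnj (u (i + j - k))) p * cnj (z k))"
  have Tg: "T (g x) = h x" for x
    unfolding T_def g_def h_def qterm_def star_def by (auto split: prod.split simp: algebra_simps)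
  have "(\<lambda>x. norm (T x)) summable_on UNIV"
    using qsummable4[of u u "star u" "star z"] assms unfolding T_def qsummable_def by simp
  then have "T summable_on UNIV" by (rule Infinite_Sum.abs_summable_summable)
  then have hs: "h summable_on UNIV \<times> UNIV"
    using summable_on_reindex_bij_betw[OF bij, of T] by (simp add: Tg)
  have ck: "(\<Sum>\<^sub>\<infinity>p. h (k, p)) = cubic u k * cnj (z k)" for k
    unfolding h_def cubic_def by (simp add: infsum_cmult_left')
  have "qform u u (star u) (star z) = infsum h (UNIV \<times> UNIV)"
    using infsum_reindex_bij_betw[OF bij, of T] by (simp add: Tg qform_def flip: T_def)
  also have "\<dots> = (\<Sum>\<^sub>\<infinity>k. cubic u k * cnj (z k))"
    using infsum_Sigma_banach[OF hs] by (simp add: ck)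
  finally have "Re (qform u u (star u) (star z)) = Re (\<Sum>\<^sub>\<infinity>k. cubic u k * cnj (z k))" by simp
  also have "\<dots> = (\<Sum>\<^sub>\<infinity>k. Re (cubic u k * cnj (z k)))"
    using summable_on_Sigma_banach[of "\<lambda>k p. h (k, p)" UNIV "\<lambda>_. UNIV"] hs
    by (intro infsum_Re[symmetric]) (simp add: ck case_prod_eta)
  also have "\<dots> = rinner (cubic u) z"
    unfolding rinner_def by (simp add: inner_complex_def)
  finally show ?thesis by simp
qed

text \<open>This is - \<i> d/dx, so that applying it twice gives - d^2/dx^2.\<close>

definition Dx :: "real \<Rightarrow> fcoef \<Rightarrow> fcoef" where
  "Dx L c = (\<lambda>k. complex_of_real (wavenum L k) * c k)"

lemma dxx_Dx: "dxx L c = (\<lambda>k. - Dx L (Dx L c) k)"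
  unfolding dxx_def Dx_def by (simp add: power2_eq_square mult.assoc)

lemma star_Dx: "star (Dx L c) = (\<lambda>k. - Dx L (star c) k)"
  unfolding star_def Dx_def wavenum_def by simp

lemma Dx_diff: "Dx L (\<lambda>k. a k - b k) = (\<lambda>k. Dx L a k - Dx L b k)"
  unfolding Dx_def by (simp add: algebra_simps)

lemma rinner_Dx: "rinner (Dx L a) b = rinner a (Dx L b)"
  unfolding rinner_def Dx_def by (simp add: inner_complex_def algebra_simps)

text \<open>The derivative of a periodic product has integral zero. On coefficients this holds term
  by term, because \<open>wavenum\<close> is additive and the four frequencies add up to
  zero.\<close>

lemma qform_Leibniz:
  assumes "qsummable (Dx L a) b c d" "qsummable a (Dx L b) c d"
    "qsummable a b (Dx L c) d" "qsummable a b c (Dx L d)"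
  shows "qform (Dx L a) b c d + qform a (Dx L b) c d + qform a b (Dx L c) d + qform a b c (Dx L d) = 0"
proof -
  have s: "qterm (Dx L a) b c d summable_on UNIV" "qterm a (Dx L b) c d summable_on UNIV"
    "qterm a b (Dx L c) d summable_on UNIV" "qterm a b c (Dx L d) summable_on UNIV"
    using assms unfolding qsummable_def by (auto intro: Infinite_Sum.abs_summable_summable)
  have w: "wavenum L (- i - j - k) = - wavenum L i - wavenum L j - wavenum L k" for i j k
    unfolding wavenum_def by (simp add: algebra_simps add_divide_distrib diff_divide_distrib)
  have "qterm (Dx L a) b c d x + qterm a (Dx L b) c d x + qterm a b (Dx L c) d x + qterm a b c (Dx L d) x = 0" for x
  proof -
    obtain i j k where x: "x = ((i, j), k)" by (metis surj_pair)
    show ?thesis unfolding x qterm_def Dx_def prod.case w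
      by (simp add: algebra_simps)
  qed
  then have "infsum (\<lambda>x. qterm (Dx L a) b c d x + qterm a (Dx L b) c d x + qterm a b (Dx L c) d x + qterm a b c (Dx L d) x) UNIV = 0"
    by (simp del: add_eq_0_iff)
  then show ?thesis unfolding qform_def by (simp add: infsum_add s summable_on_add)
qed

section \<open>Control of the l1 norm by the derivative\<close>

lemma inverse_square_summable_on_int: "(\<lambda>k::int. 1 / (real_of_int k)\<^sup>2) summable_on UNIV"
proof -
  have "summable (\<lambda>n. 1 / (real n)\<^sup>2)"
    using inverse_power_summable[of 2, where 'a = real] by (simp add: field_simps)
  then have n: "(\<lambda>n. 1 / (real n)\<^sup>2) summable_on UNIV"
    by (rule summable_nonneg_imp_summable_on) simp
  have 1: "(\<lambda>k::int. 1 / (real_of_int k)\<^sup>2) summable_on range int"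
    using summable_on_reindex[of int UNIV "\<lambda>k::int. 1 / (real_of_int k)\<^sup>2"] n
    by (simp add: o_def)
  have 2: "(\<lambda>k::int. 1 / (real_of_int k)\<^sup>2) summable_on range (\<lambda>n. - int n)"
    using summable_on_reindex[of "\<lambda>n. - int n" UNIV "\<lambda>k::int. 1 / (real_of_int k)\<^sup>2"] n
    by (simp add: o_def inj_on_def)
  have "range int \<union> range (\<lambda>n. - int n) = UNIV"
    by (auto intro: int_cases3) (metis int_cases2 rangeI)
  with summable_on_union[OF 1 2] show ?thesis by simp
qed

text \<open>Write c as 1 / \<open>wavenum\<close> times \<open>Dx L c\<close> and apply
  Cauchy-Schwarz: since the low modes of c vanish, the first factor may be cut down to a tail of the
  series of 1/k^2.\<close>

lemma high_mode_bound:
  assumes L: "0 < L" and e: "0 < \<epsilon>"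
  shows "\<exists>N::nat. \<forall>m\<ge>N. \<forall>c. in_L2per (Dx L c) \<and> (\<forall>k. \<bar>k\<bar> \<le> int m \<longrightarrow> c k = 0) \<longrightarrow>
    in_l1 c \<and> l1norm c \<le> \<epsilon> * l2norm (Dx L c)"
proof -
  \<comment> \<open>At k = 0 division by zero gives the value 0, which is harmless: mode 0 is always
    among those that vanish in c.\<close>
  define r :: fcoef where "r k = complex_of_real (L / (2 * pi) * (1 / real_of_int k))" for k
  have rsq: "(cmod (r k))\<^sup>2 = (L / (2 * pi))\<^sup>2 * (1 / (real_of_int k)\<^sup>2)" for k
    unfolding r_def norm_of_real power2_abs by (simp add: power_mult_distrib power_divide)
  have r: "(\<lambda>k. (cmod (r k))\<^sup>2) summable_on UNIV"
    unfolding rsq by (rule summable_on_cmult_right[OF inverse_square_summable_on_int])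
  obtain S where S: "finite S" "dist (\<Sum>k\<in>S. (cmod (r k))\<^sup>2) (\<Sum>\<^sub>\<infinity>k. (cmod (r k))\<^sup>2) \<le> \<epsilon>\<^sup>2"
    using infsum_finite_approximation[OF r, of "\<epsilon>\<^sup>2"] e by auto
  \<comment> \<open>\<open>S\<close> need not be an interval. The modes up to N contain it, so
    whatever \<open>q\<close> retains below lies outside \<open>S\<close> and is bounded by the
    approximation error.\<close>
  define N where "N = nat (Max (insert 0 (abs ` S)))"
  have N: "\<bar>k\<bar> \<le> int N" if "k \<in> S" for k
    using Max_ge[of "insert 0 (abs ` S)" "\<bar>k\<bar>"] S(1) that unfolding N_def by auto
  show ?thesis
  proof (intro exI[of _ N] allI impI, elim conjE)
    fix m :: nat and c
    assume m: "N \<le> m" and c: "in_L2per (Dx L c)" "\<forall>k. \<bar>k\<bar> \<le> int m \<longrightarrow> c k = 0"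
    define q where "q k = (if \<bar>k\<bar> \<le> int m then 0 else r k)" for k
    have q: "L2_set (\<lambda>k. cmod (q k)) T \<le> \<epsilon>" if T: "finite T" for T
    proof -
      have "(\<Sum>k\<in>T. (cmod (q k))\<^sup>2) = (\<Sum>k\<in>T - S. (cmod (q k))\<^sup>2)"
        using T N m by (intro sum.mono_neutral_right) (force simp: q_def)+
      also have "\<dots> \<le> (\<Sum>k\<in>T - S. (cmod (r k))\<^sup>2)"
        by (intro sum_mono) (auto simp: q_def)
      also have "\<dots> = (\<Sum>k\<in>(T - S) \<union> S. (cmod (r k))\<^sup>2) - (\<Sum>k\<in>S. (cmod (r k))\<^sup>2)"
        using T S(1) by (subst sum.union_disjoint) auto
      also have "(\<Sum>k\<in>(T - S) \<union> S. (cmod (r k))\<^sup>2) \<le> (\<Sum>\<^sub>\<infinity>k. (cmod (r k))\<^sup>2)"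
        using T S(1) by (intro finite_sum_le_infsum r) auto
      also have "(\<Sum>\<^sub>\<infinity>k. (cmod (r k))\<^sup>2) - (\<Sum>k\<in>S. (cmod (r k))\<^sup>2) \<le> \<epsilon>\<^sup>2"
        using S(2) unfolding dist_real_def by linarith
      finally have "(\<Sum>k\<in>T. (cmod (q k))\<^sup>2) \<le> \<epsilon>\<^sup>2" by simp
      then show ?thesis unfolding L2_set_def using e real_le_lsqrt by simp
    qed
    have q2: "in_L2per q" "l2norm q \<le> \<epsilon>" using l2norm_bound[of q, OF q] by auto
    have ceq: "c = (\<lambda>k. q k * Dx L c k)"
    proof
      fix k show "c k = q k * Dx L c k"
        using c(2) L by (auto simp: q_def r_def Dx_def wavenum_def simp flip: of_real_mult of_real_divide)
    qed
    have "in_l1 (\<lambda>k. q k * Dx L c k)" "l1norm (\<lambda>k. q k * Dx L c k) \<le> l2norm q * l2norm (Dx L c)"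
      by (intro cauchy_schwarz_summable cauchy_schwarz q2 c)+
    moreover have "l2norm q * l2norm (Dx L c) \<le> \<epsilon> * l2norm (Dx L c)"
      using q2 by (intro mult_right_mono) auto
    ultimately show "in_l1 c \<and> l1norm c \<le> \<epsilon> * l2norm (Dx L c)"
      using ceq by simp
  qed
qed

text \<open>Takes the place of Agmon's inequality. Low modes are bounded one by one by the l2 norm,
  so C is their number; the others fall under \<open>high_mode_bound\<close>. The freedom in
  \<epsilon> later lets the quartic term be absorbed into |u_x|^2.\<close>

lemma l1norm_interpolation:
  assumes L: "0 < L" and e: "0 < \<epsilon>"
  shows "\<exists>C\<ge>0. \<forall>c. in_L2per c \<and> in_L2per (Dx L c) \<longrightarrow>
    in_l1 c \<and> l1norm c \<le> C * l2norm c + \<epsilon> * l2norm (Dx L c)"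
proof -
  obtain N :: nat where N: "\<And>c. in_L2per (Dx L c) \<Longrightarrow> (\<forall>k. \<bar>k\<bar> \<le> int N \<longrightarrow> c k = 0) \<Longrightarrow>
    in_l1 c \<and> l1norm c \<le> \<epsilon> * l2norm (Dx L c)"
    using high_mode_bound[OF assms] by blast
  let ?I = "{- int N..int N}"
  show ?thesis
  proof (rule exI[of _ "real (card ?I)"], rule conjI, simp, intro allI impI, elim conjE)
    fix c assume c: "in_L2per c" "in_L2per (Dx L c)"
    define q where "q = (\<lambda>k. if \<bar>k\<bar> \<le> int N then 0 else c k)"
    have "cmod (Dx L q k) \<le> cmod (Dx L c k)" for k
      by (simp add: q_def Dx_def)
    note q = l2norm_mono[OF c(2) this]
    have q1: "in_l1 q" "l1norm q \<le> \<epsilon> * l2norm (Dx L q)"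
      using N[OF q(1)] by (auto simp: q_def)
    have p: "(\<Sum>k\<in>S. cmod (proj N c k)) \<le> real (card ?I) * l2norm c" if "finite S" for S
    proof -
      have "(\<Sum>k\<in>S. cmod (proj N c k)) \<le> (\<Sum>k\<in>S \<union> ?I. cmod (proj N c k))"
        using that by (intro sum_mono2) auto
      also have "\<dots> = (\<Sum>k\<in>?I. cmod (proj N c k))"
        using that by (intro sum.mono_neutral_right) (auto simp: proj_def)
      also have "\<dots> \<le> (\<Sum>k\<in>?I. l2norm c)"
        using coeff_le_l2norm[OF c(1)] by (intro sum_mono) (auto simp: proj_def)
      finally show ?thesis by simp
    qed
    have p1: "in_l1 (proj N c)" "l1norm (proj N c) \<le> real (card ?I) * l2norm c"
      using l1norm_bound[of "proj N c", OF p] by auto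
    have "c = (\<lambda>k. proj N c k + q k)" by (auto simp: proj_def q_def)
    then have "in_l1 c" "l1norm c \<le> l1norm (proj N c) + l1norm q"
      using in_l1_add[OF p1(1) q1(1)] l1norm_triangle[OF p1(1) q1(1)] by simp_all
    moreover have "\<epsilon> * l2norm (Dx L q) \<le> \<epsilon> * l2norm (Dx L c)"
      using q(2) e by simp
    ultimately show "in_l1 c \<and> l1norm c \<le> real (card ?I) * l2norm c + \<epsilon> * l2norm (Dx L c)"
      using p1 q1 by linarith
  qed
qed

text \<open>The bound B only has to exist: multiplied by exp (g s) it disappears as s tends to minus
  infinity. This is how mere boundedness on the whole line becomes a bound by the data.\<close>

lemma backward_Gronwall:
  fixes y y' :: "real \<Rightarrow> real"
  assumes g: "0 < g"
    and y: "\<And>t. (y has_real_derivative y' t) (at t)"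
    and ineq: "\<And>t. y' t \<le> - g * y t + C"
    and B: "\<And>t. y t \<le> B"
  shows "y t \<le> C / g"
proof -
  define z where "z s = exp (g * s) * (y s - C / g)" for s
  have z: "(z has_real_derivative exp (g * s) * (y' s + g * y s - C)) (at s)" for s
    unfolding z_def using g
    by (auto intro!: derivative_eq_intros y simp: algebra_simps)
  have dec: "z t \<le> z s" if "s \<le> t" for s
  proof (rule DERIV_nonpos_imp_nonincreasing[OF that])
    fix x show "\<exists>d. DERIV z x :> d \<and> d \<le> 0"
      using z[of x] ineq[of x] by (intro exI conjI) (auto intro!: mult_nonneg_nonpos)
  qed
  have "((\<lambda>s. exp (g * s) * (B - C / g)) \<longlongrightarrow> 0) at_bot"
    by (intro tendsto_mult_left_zero filterlim_compose[OF exp_at_bot]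
        filterlim_tendsto_pos_mult_at_bot[OF tendsto_const g filterlim_ident])
  moreover have "\<forall>\<^sub>F s in at_bot. z t \<le> exp (g * s) * (B - C / g)"
    using eventually_le_at_bot[of t]
  proof eventually_elim
    case (elim s)
    then have "z t \<le> z s" by (rule dec)
    also have "\<dots> \<le> exp (g * s) * (B - C / g)" unfolding z_def using B[of s] by simp
    finally show ?case .
  qed
  ultimately have "z t \<le> 0"
    by (rule tendsto_lowerbound) (rule trivial_limit_at_bot_linorder)
  then show ?thesis unfolding z_def by (simp add: mult_le_0_iff)
qed

section \<open>Energy estimates for a trajectory\<close>

lemma l2_cont_diff:
  assumes "l2_cont a t" "l2_cont b t" shows "l2_cont (\<lambda>s k. a s k - b s k) t"
proof -
  have s: "in_L2per (a s)" "in_L2per (b s)" for s using assms by (auto simp: l2_cont_def)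
  have "((\<lambda>h. l2norm (\<lambda>k. a (t + h) k - a t k) + l2norm (\<lambda>k. b (t + h) k - b t k)) \<longlongrightarrow> 0 + 0) (at 0)"
    using assms by (intro tendsto_add) (auto simp: l2_cont_def)
  then have lim: "((\<lambda>h. l2norm (\<lambda>k. a (t + h) k - a t k) + l2norm (\<lambda>k. b (t + h) k - b t k)) \<longlongrightarrow> 0) (at 0)"
    by simp
  have le: "l2norm (\<lambda>k. (a (t + h) k - b (t + h) k) - (a t k - b t k)) \<le>
      l2norm (\<lambda>k. a (t + h) k - a t k) + l2norm (\<lambda>k. b (t + h) k - b t k)" for h
  proof -
    have "(\<lambda>k. (a (t + h) k - b (t + h) k) - (a t k - b t k)) =
      (\<lambda>k. (a (t + h) k - a t k) - (b (t + h) k - b t k))" by (auto simp: algebra_simps)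
    then show ?thesis
      using l2norm_triangle_diff[of "\<lambda>k. a (t + h) k - a t k" "\<lambda>k. b (t + h) k - b t k"]
      by (simp add: s in_L2per_diff)
  qed
  have "((\<lambda>h. l2norm (\<lambda>k. (a (t + h) k - b (t + h) k) - (a t k - b t k))) \<longlongrightarrow> 0) (at 0)"
    by (rule Lim_null_comparison[OF _ lim]) (simp add: le)
  then show ?thesis using s by (simp add: l2_cont_def in_L2per_diff)
qed

lemma in_L2per_Dx:
  assumes "in_L2per c" "in_L2per (Dx L (Dx L c))"
  shows "in_L2per (Dx L c)" "l2norm (Dx L c) \<le> l2norm c + l2norm (Dx L (Dx L c))"
proof -
  have le: "cmod (Dx L c k) \<le> cmod (c k + Dx L (Dx L c) k)" for k
  proof -
    have "c k + Dx L (Dx L c) k = complex_of_real (1 + (wavenum L k)\<^sup>2) * c k"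
      by (simp add: Dx_def algebra_simps power2_eq_square)
    then have "cmod (c k + Dx L (Dx L c) k) = (1 + (wavenum L k)\<^sup>2) * cmod (c k)"
      by (metis abs_of_nonneg norm_mult norm_of_real sum_power2_ge_zero one_power2)
    moreover have "\<bar>wavenum L k\<bar> \<le> 1 + (wavenum L k)\<^sup>2"
      using sum_squares_bound[of 1 "\<bar>wavenum L k\<bar>"] by simp
    ultimately show ?thesis by (simp add: Dx_def norm_mult mult_right_mono)
  qed
  note m = l2norm_mono[OF in_L2per_add[OF assms] le]
  show "in_L2per (Dx L c)" by (rule m)
  show "l2norm (Dx L c) \<le> l2norm c + l2norm (Dx L (Dx L c))"
    using m(2) l2norm_triangle[OF assms] by linarith
qed

lemma rinner_DDx_self: "rinner (Dx L (Dx L c)) c = (l2norm (Dx L c))\<^sup>2"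
  by (simp add: rinner_Dx rinner_self)

text \<open>The second derivative in space is only continuous in time. By symmetry of the form its
  increment factors as x^2 - y^2 = (x + y)(x - y): the sum of the second derivatives at both times
  is paired with the increment of a, so an l2 derivative of a suffices.\<close>

lemma Dx_energy_deriv:
  assumes "l2_cont a t" "l2_cont (\<lambda>s. Dx L (Dx L (a s))) t" "l2_deriv a a' t"
  shows "((\<lambda>s. rinner (Dx L (Dx L (a s))) (a s)) has_real_derivative 2 * rinner (Dx L (Dx L (a t))) a') (at t)"
proof -
  let ?D = "\<lambda>s. Dx L (Dx L (a s))"
  let ?\<Delta> = "\<lambda>h k. (a (t + h) k - a t k) / complex_of_real h"
  have s: "in_L2per (a r)" "in_L2per (?D r)" for r
    using assms by (auto simp: l2_cont_def)
  have s': "in_L2per a'" using assms by (auto simp: l2_deriv_def)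
  have d: "in_L2per (?\<Delta> h)" for h
    using in_L2per_scale[OF in_L2per_diff[OF s(1) s(1)], of "1 / complex_of_real h"] by simp
  have sw: "rinner (?D r) (a r') = rinner (?D r') (a r)" for r r'
    by (metis rinner_Dx rinner_commute)
  have eq: "(rinner (?D (t + h)) (a (t + h)) - rinner (?D t) (a t)) / h =
      rinner (\<lambda>k. ?D (t + h) k + ?D t k) (?\<Delta> h)" for h
  proof -
    have "rinner (\<lambda>k. ?D (t + h) k + ?D t k) (?\<Delta> h) =
        (rinner (\<lambda>k. ?D (t + h) k + ?D t k) (a (t + h)) - rinner (\<lambda>k. ?D (t + h) k + ?D t k) (a t)) / h"
      unfolding rinner_commute[of "\<lambda>k. ?D (t + h) k + ?D t k"]
      by (intro rinner_quotient s in_L2per_add)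
    then show ?thesis
      by (simp add: rinner_add_left s sw[of "t + h" t])
  qed
  have "((\<lambda>h. rinner (\<lambda>k. ?D (t + h) k + ?D t k) (?\<Delta> h)) \<longlongrightarrow> rinner (\<lambda>k. ?D t k + ?D t k) a') (at 0)"
    using assms by (intro rinner_tendsto s s' d in_L2per_add) (auto simp: l2_cont_def l2_deriv_def)
  moreover have "rinner (\<lambda>k. ?D t k + ?D t k) a' = 2 * rinner (?D t) a'"
    by (simp only: rinner_add_left[OF s(2) s(2) s'] mult_2)
  ultimately show ?thesis unfolding DERIV_def eq by simp
qed

lemma rinner_i_left: "rinner (\<lambda>k. \<i> * a k) b = - rinner a (\<lambda>k. \<i> * b k)"
proof -
  have "(\<i> * x) \<bullet> y = - (x \<bullet> (\<i> * y))" for x y :: complex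
    by (simp add: inner_complex_def)
  then show ?thesis unfolding rinner_def by (simp add: infsum_uminus)
qed

lemma qform_scale4: "qform a b c (\<lambda>k. z * d k) = z * qform a b c d"
  unfolding qform_rot4[of a b c] by (rule qform_scale1)

lemma quartic_Im: "Im (qform u u (star u) (star u)) = 0"
proof -
  have "cnj (qform u u (star u) (star u)) = qform (star u) (star u) u u"
    using qform_star[of u u "star u" "star u"] by simp
  also have "\<dots> = qform u u (star u) (star u)"
    by (metis qform_swap12 qform_swap23 qform_swap34)
  finally show ?thesis by (metis Reals_cnj_iff complex_is_Real_iff)
qed

text \<open>Testing with the cubic term itself avoids a convolution inequality.\<close>

lemma cubic_bound:
  assumes "in_l1 u" "in_L2per (cubic u)"
  shows "l2norm (cubic u) \<le> l1norm u * l1norm u * l2norm u"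
proof -
  have "(l2norm (cubic u))\<^sup>2 = Re (qform u u (star u) (star (cubic u)))"
    using qform_cubic[OF assms] by (simp add: rinner_self)
  also have "\<dots> \<le> l1norm u * l1norm u * l2norm (star u) * l2norm (star (cubic u))"
    using assms by (intro order_trans[OF complex_Re_le_cmod] qform_summable_bound) (auto intro: in_l1_imp_L2per)
  finally have "l2norm (cubic u) * l2norm (cubic u) \<le> (l1norm u * l1norm u * l2norm u) * l2norm (cubic u)"
    by (simp add: power2_eq_square)
  then show ?thesis
    using l2norm_nonneg[of "cubic u"] by (cases "l2norm (cubic u) = 0") (auto simp: mult_le_cancel_right)
qed

text \<open>The form of a trajectory on which all estimates run. The signs in \<open>eq\<close> come
  from \<open>Dx\<close> squared being minus the second derivative. In \<open>bounded\<close> the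
  bound may depend on the trajectory; it serves only as input to the backward Gronwall
  argument.\<close>

locale nls_trajectory =
  fixes L \<gamma> :: real and f :: fcoef and u ut :: "real \<Rightarrow> fcoef"
  assumes L: "0 < L" and \<gamma>: "0 < \<gamma>" and f: "in_L2per f"
    and u1: "in_l1 (u t)" and Du1: "in_l1 (Dx L (u t))" and DDu2: "in_L2per (Dx L (Dx L (u t)))"
    and cubic2: "in_L2per (cubic (u t))"
    and cont: "l1_cont u t" and DD_cont: "l2_cont (\<lambda>s. Dx L (Dx L (u s))) t"
    and deriv: "l2_deriv u (ut t) t"
    and eq: "ut t = (\<lambda>k. - \<i> * (Dx L (Dx L (u t)) k - cubic (u t) k + f k) - complex_of_real \<gamma> * u t k)"
    and bounded: "\<exists>B. \<forall>t. l2norm (u t) \<le> B \<and> l2norm (Dx L (u t)) \<le> B"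
begin

lemma u2: "in_L2per (u t)"
  by (rule in_l1_imp_L2per[OF u1])

lemma Du2: "in_L2per (Dx L (u t))"
  by (rule in_l1_imp_L2per[OF Du1])

lemma ut2: "in_L2per (ut t)"
  using deriv[of t] by (simp add: l2_deriv_def)

lemma cont2: "l2_cont u t"
  by (rule l1_cont_imp_l2_cont[OF cont])

text \<open>Half the L2 gradient of \<open>energy\<close> below. The equation becomes u_t = - i G -
  \<gamma> u, a damped Hamiltonian flow.\<close>

definition G :: "real \<Rightarrow> fcoef" where
  "G t = (\<lambda>k. Dx L (Dx L (u t)) k - cubic (u t) k + f k)"

lemma G2: "in_L2per (G t)"
  unfolding G_def by (intro in_L2per_add in_L2per_diff DDu2 cubic2 f)

lemma rinner_ut: "in_L2per z \<Longrightarrow> rinner (ut t) z = rinner (G t) (\<lambda>k. \<i> * z k) - \<gamma> * rinner (u t) z"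
proof -
  assume z: "in_L2per z"
  have "ut t = (\<lambda>k. - (\<i> * G t k) - complex_of_real \<gamma> * u t k)"
    unfolding eq[of t] G_def by (simp add: algebra_simps)
  then have "rinner (ut t) z = rinner (\<lambda>k. - (\<i> * G t k)) z - rinner (\<lambda>k. complex_of_real \<gamma> * u t k) z"
    using rinner_diff_left[of "\<lambda>k. - (\<i> * G t k)" "\<lambda>k. complex_of_real \<gamma> * u t k" z]
      in_L2per_uminus[OF in_L2per_scale[OF G2[of t], of \<i>]] in_L2per_scale[OF u2[of t]] z by simp
  then show ?thesis by (simp add: rinner_uminus_left rinner_i_left rinner_scale_left)
qed

lemma rinner_cubic: "rinner (cubic (u t)) (u t) = Re (qform (u t) (u t) (star (u t)) (star (u t)))"
  by (rule qform_cubic[OF u1 u2])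

text \<open>Dispersion and nonlinearity preserve mass: pairing either of them with i u gives the
  real part of i times a real number. Forcing and damping remain.\<close>

lemma mass_deriv:
  "((\<lambda>s. rinner (u s) (u s)) has_real_derivative
     2 * rinner f (\<lambda>k. \<i> * u t k) - 2 * \<gamma> * rinner (u t) (u t)) (at t)"
proof -
  have i2: "in_L2per (\<lambda>k. \<i> * u t k)" by (intro in_L2per_scale u2)
  have 1: "rinner (Dx L (Dx L (u t))) (\<lambda>k. \<i> * u t k) = 0"
    unfolding rinner_def Dx_def by (simp add: inner_complex_def algebra_simps)
  have "star (\<lambda>k. \<i> * u t k) = (\<lambda>k. - \<i> * star (u t) k)"
    by (simp add: star_def)
  then have 2: "rinner (cubic (u t)) (\<lambda>k. \<i> * u t k) = 0"
    using qform_cubic[OF u1 i2, of t] qform_scale4[of "u t" "u t" "star (u t)" "- \<i>" "star (u t)"]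
      quartic_Im[of "u t"] by simp
  have "rinner (G t) (\<lambda>k. \<i> * u t k) = rinner f (\<lambda>k. \<i> * u t k)"
    unfolding G_def using 1 2 by (simp add: rinner_add_left rinner_diff_left in_L2per_diff DDu2 cubic2 f i2)
  then have "rinner (ut t) (u t) = rinner f (\<lambda>k. \<i> * u t k) - \<gamma> * rinner (u t) (u t)"
    by (simp add: rinner_ut u2)
  then show ?thesis
    using rinner_deriv[OF cont2 cont2 deriv deriv, of t] by (simp add: rinner_commute[of "u t" "ut t"] mult.assoc)
qed

lemma mass_bound: "l2norm (u t) \<le> l2norm f / \<gamma>"
proof -
  obtain B where B: "\<And>t. l2norm (u t) \<le> B" using bounded by blast
  have "rinner (u t) (u t) \<le> ((l2norm f)\<^sup>2 / \<gamma>) / \<gamma>"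
  proof (rule backward_Gronwall[OF \<gamma> mass_deriv])
    fix s
    have "rinner f (\<lambda>k. \<i> * u s k) \<le> l2norm f * l2norm (u s)"
      using rinner_bound[OF f in_L2per_scale[OF u2[of s], of \<i>]] by (simp add: l2norm_scale)
    \<comment> \<open>Young's inequality, weighted so that it consumes half of the damping 2
      \<gamma>.\<close>
    moreover have "2 * (l2norm f * l2norm (u s)) \<le> (l2norm f)\<^sup>2 / \<gamma> + \<gamma> * (l2norm (u s))\<^sup>2"
    proof -
      have "0 \<le> (l2norm f - \<gamma> * l2norm (u s))\<^sup>2 / \<gamma>" using \<gamma> by simp
      then show ?thesis using \<gamma> by (simp add: power2_eq_square field_simps)
    qed
    ultimately show "2 * rinner f (\<lambda>k. \<i> * u s k) - 2 * \<gamma> * rinner (u s) (u s) \<le> - \<gamma> * rinner (u s) (u s) + (l2norm f)\<^sup>2 / \<gamma>"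
      by (simp add: rinner_self)
  next
    fix s show "rinner (u s) (u s) \<le> B\<^sup>2" using B[of s] by (simp add: rinner_self power_mono)
  qed
  then have "(l2norm (u t))\<^sup>2 \<le> (l2norm f / \<gamma>)\<^sup>2" by (simp add: rinner_self power2_eq_square)
  then show ?thesis using \<gamma> by (simp add: power2_le_iff_abs_le)
qed

definition energy :: "real \<Rightarrow> real" where
  "energy t = rinner (Dx L (Dx L (u t))) (u t) - Re (qform (u t) (u t) (star (u t)) (star (u t))) / 2 + 2 * rinner f (u t)"

text \<open>Differentiating any of the four factors of |u|^4 gives the same real part: permuting
  arguments and conjugating carries each contribution into the pairing of the cubic term with
  u_t.\<close>

lemma quartic_deriv:
  "((\<lambda>s. Re (qform (u s) (u s) (star (u s)) (star (u s)))) has_real_derivative 4 * rinner (cubic (u t)) (ut t)) (at t)"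
proof -
  note c = cont[of t] l1_cont_star[OF cont[of t]] and d = deriv[of t] l2_deriv_star[OF deriv[of t]]
  let ?u = "u t" and ?s = "star (u t)" and ?z = "star (ut t)"
  have 4: "Re (qform ?u ?u ?s ?z) = rinner (cubic ?u) (ut t)"
    by (simp add: qform_cubic u1 ut2)
  have 3: "qform ?u ?u ?z ?s = qform ?u ?u ?s ?z" by (rule qform_swap34)
  have "cnj (qform (ut t) ?u ?s ?s) = qform ?z ?s ?u ?u"
    using qform_star[of "ut t" ?u ?s ?s] by simp
  also have "\<dots> = qform ?u ?u ?s ?z"
    by (metis qform_swap12 qform_swap23 qform_swap34)
  finally have 1: "Re (qform (ut t) ?u ?s ?s) = rinner (cubic ?u) (ut t)"
    using 4 by (metis cnj.simps(1))
  have 2: "qform ?u (ut t) ?s ?s = qform (ut t) ?u ?s ?s" by (rule qform_swap12)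
  show ?thesis
    using qform_deriv[OF c(1,1,2,2) d(1,1,2,2)] unfolding 2 3 1 4 by simp
qed

text \<open>The conservative part drops out because G is orthogonal to i G. Damping makes a part
  homogeneous of degree d decay at rate d \<gamma>; measured against the common rate 2 \<gamma>, the
  parts of degree 4 and 1 leave the two corrections.\<close>

lemma energy_deriv:
  "(energy has_real_derivative
     - 2 * \<gamma> * energy t + \<gamma> * Re (qform (u t) (u t) (star (u t)) (star (u t))) + 2 * \<gamma> * rinner f (u t)) (at t)"
proof -
  have "(energy has_real_derivative 2 * rinner (Dx L (Dx L (u t))) (ut t) - 4 * rinner (cubic (u t)) (ut t) / 2
      + 2 * (rinner (\<lambda>k. 0) (u t) + rinner f (ut t))) (at t)"
    unfolding energy_def[abs_def]
    by (intro DERIV_add DERIV_diff DERIV_cmult DERIV_cdivide Dx_energy_deriv rinner_deriv quartic_deriv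
        cont2 DD_cont deriv l2_cont_const f l2_deriv_const)
  moreover have "2 * rinner (Dx L (Dx L (u t))) (ut t) - 4 * rinner (cubic (u t)) (ut t) / 2
      + 2 * (rinner (\<lambda>k. 0) (u t) + rinner f (ut t)) = 2 * rinner (G t) (ut t)"
  proof -
    have "rinner (G t) (ut t) = rinner (Dx L (Dx L (u t))) (ut t) - rinner (cubic (u t)) (ut t) + rinner f (ut t)"
      unfolding G_def by (simp add: rinner_add_left rinner_diff_left in_L2per_diff DDu2 cubic2 f ut2)
    moreover have "rinner (\<lambda>k. 0) (u t) = 0" by (simp add: rinner_def)
    ultimately show ?thesis by simp
  qed
  moreover have "2 * rinner (G t) (ut t) = - 2 * \<gamma> * energy t
      + \<gamma> * Re (qform (u t) (u t) (star (u t)) (star (u t))) + 2 * \<gamma> * rinner f (u t)"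
  proof -
    have 1: "rinner (G t) (ut t) = - \<gamma> * rinner (u t) (G t)"
      unfolding rinner_commute[of "G t" "ut t"] rinner_ut[OF G2] by (simp add: rinner_i_self)
    have 2: "rinner (u t) (G t) = rinner (Dx L (Dx L (u t))) (u t)
        - Re (qform (u t) (u t) (star (u t)) (star (u t))) + rinner f (u t)"
      unfolding rinner_commute[of "u t"] rinner_cubic[symmetric] unfolding G_def
      by (simp add: rinner_add_left rinner_diff_left in_L2per_diff DDu2 cubic2 f u2)
    show ?thesis unfolding 1 2 energy_def by (simp add: algebra_simps)
  qed
  ultimately show ?thesis by simp
qed

lemma quartic_bound:
  "\<bar>Re (qform (u t) (u t) (star (u t)) (star (u t)))\<bar> \<le> (l1norm (u t))\<^sup>2 * (l2norm (u t))\<^sup>2"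
  using order_trans[OF abs_Re_le_cmod qform_summable_bound(2)[of "u t" "u t" "star (u t)" "star (u t)"]]
  by (simp add: u1 u2 power2_eq_square mult.assoc)

end

text \<open>The order of quantifiers is the point: R is fixed from \<gamma>, L and F before any
  force or trajectory is given. The third quantity is u_t stripped of its second-derivative
  part.\<close>

lemma nls_trajectory_uniform_bound:
  assumes L: "0 < L" and g: "0 < \<gamma>" and nf: "0 \<le> F"
  shows "\<exists>R. \<forall>f u ut t. nls_trajectory L \<gamma> f u ut \<and> l2norm f \<le> F \<longrightarrow>
    l1norm (u t) \<le> R \<and> l2norm (Dx L (u t)) \<le> R \<and> l2norm (\<lambda>k. \<i> * cubic (u t) k - \<i> * f k - complex_of_real \<gamma> * u t k) \<le> R"
proof -
  define r where "r = F / \<gamma>"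
  have r0: "0 \<le> r" unfolding r_def using g nf by simp
  \<comment> \<open>With r bounding the mass norm, \<open>r * \<epsilon>\<close> is at most 1/2; the
    quartic term then costs at most half of |u_x|^2.\<close>
  define \<epsilon> where "\<epsilon> = 1 / (2 * (r + 1))"
  have e: "0 < \<epsilon>" unfolding \<epsilon>_def using r0 by simp
  have re: "r * \<epsilon> \<le> 1 / 2" unfolding \<epsilon>_def using r0 by (simp add: field_simps)
  obtain C where C0: "0 \<le> C" and C: "\<And>c. in_L2per c \<Longrightarrow> in_L2per (Dx L c) \<Longrightarrow> l1norm c \<le> C * l2norm c + \<epsilon> * l2norm (Dx L c)"
    using l1norm_interpolation[OF L e] by blast
  \<comment> \<open>K is the part of the quartic bound without derivatives, 2 (C r)^2 r^2. Z comes
    from solving for |u_x|^2 at the end: 3/4 |u_x|^2 \<le> 2 K + 6 F r, rounded up.\<close>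
  define K where "K = 2 * C\<^sup>2 * r^4"
  define Z where "Z = 3 * K + 8 * F * r"
  define R1 where "R1 = C * r + \<epsilon> * sqrt Z"
  define R where "R = R1 + sqrt Z + (R1 * R1 * r + F + \<gamma> * r)"
  have K0: "0 \<le> K" unfolding K_def using r0 by simp
  have Z0: "0 \<le> Z" unfolding Z_def using K0 nf r0 by simp
  have R10: "0 \<le> R1" unfolding R1_def using C0 r0 e Z0 by simp
  have "l1norm (u t) \<le> R \<and> l2norm (Dx L (u t)) \<le> R \<and> l2norm (\<lambda>k. \<i> * cubic (u t) k - \<i> * f k - complex_of_real \<gamma> * u t k) \<le> R"
    if tr: "nls_trajectory L \<gamma> f u ut" and fF: "l2norm f \<le> F" for f u ut t
  proof -
    interpret nls_trajectory L \<gamma> f u ut by (rule tr)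
    let ?q = "\<lambda>s. Re (qform (u s) (u s) (star (u s)) (star (u s)))" and ?Y = "\<lambda>s. (l2norm (Dx L (u s)))\<^sup>2"
    have m: "l2norm (u s) \<le> r" for s
      using mass_bound[of s] fF g unfolding r_def by (meson divide_right_mono less_imp_le order_trans)
    have l1norm: "l1norm (u s) \<le> C * r + \<epsilon> * l2norm (Dx L (u s))" for s
      using C[OF u2 Du2, of s] mult_left_mono[OF m[of s] C0] by linarith
    have q: "\<bar>?q s\<bar> \<le> K + ?Y s / 2" for s
    proof -
      have "(l1norm (u s))\<^sup>2 \<le> (C * r + \<epsilon> * l2norm (Dx L (u s)))\<^sup>2"
        by (intro power_mono l1norm) simp
      also have "\<dots> \<le> 2 * (C * r)\<^sup>2 + 2 * (\<epsilon> * l2norm (Dx L (u s)))\<^sup>2"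
        using sum_squares_bound[of "C * r" "\<epsilon> * l2norm (Dx L (u s))"] by (simp add: power2_sum)
      finally have "(l1norm (u s))\<^sup>2 * (l2norm (u s))\<^sup>2 \<le> (2 * (C * r)\<^sup>2 + 2 * (\<epsilon> * l2norm (Dx L (u s)))\<^sup>2) * r\<^sup>2"
        by (intro mult_mono power_mono m) auto
      also have "\<dots> = K + 2 * (r * \<epsilon>)\<^sup>2 * ?Y s"
        unfolding K_def by (simp add: power_mult_distrib algebra_simps flip: power_add)
      also have "\<dots> \<le> K + 2 * (1 / 2)\<^sup>2 * ?Y s"
        using re r0 e by (intro add_left_mono mult_right_mono mult_left_mono power_mono) auto
      finally show ?thesis using quartic_bound[of s] by (simp add: power2_eq_square)
    qed
    have fu: "\<bar>rinner f (u s)\<bar> \<le> F * r" for s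
    proof -
      have "\<bar>rinner f (u s)\<bar> \<le> l2norm f * l2norm (u s)" by (rule rinner_bound[OF f u2])
      also have "\<dots> \<le> F * r" by (intro mult_mono fF m nf) auto
      finally show ?thesis .
    qed
    have en: "energy s = ?Y s - ?q s / 2 + 2 * rinner f (u s)" for s
      unfolding energy_def by (simp add: rinner_DDx_self)
    obtain B where B: "\<And>t. l2norm (Dx L (u t)) \<le> B" using bounded by blast
    have "energy t \<le> (\<gamma> * (3 / 2 * K + 4 * F * r)) / \<gamma>"
    proof (rule backward_Gronwall[OF g energy_deriv])
      fix s
      \<comment> \<open>Since \<open>energy\<close> contains the quartic term with weight - 1/2, it
        has to be estimated here with weight 3/2. This costs 3/2 K and 3/4 of |u_x|^2, and
        \<open>energy\<close> supplies a full |u_x|^2.\<close>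
      have "\<gamma> * (?q s + 2 * rinner f (u s)) \<le> \<gamma> * (energy s + (3 / 2 * K + 4 * F * r))"
        using q[of s] fu[of s] g zero_le_power2[of "l2norm (Dx L (u s))"] unfolding en
        by (intro mult_left_mono) linarith+
      then show "- 2 * \<gamma> * energy s + \<gamma> * ?q s + 2 * \<gamma> * rinner f (u s) \<le> - \<gamma> * energy s + \<gamma> * (3 / 2 * K + 4 * F * r)"
        by (simp add: algebra_simps)
    next
      fix s
      have "?Y s \<le> B\<^sup>2" by (intro power_mono B) simp
      then show "energy s \<le> 2 * B\<^sup>2 + K + 2 * F * r"
        using q[of s] fu[of s] K0 zero_le_power2[of B] unfolding en by linarith
    qed
    then have "energy t \<le> 3 / 2 * K + 4 * F * r" using g by simp
    then have "?Y t \<le> Z"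
      using q[of t] fu[of t] K0 nf r0 mult_nonneg_nonneg[OF nf r0] unfolding en Z_def by linarith
    then have Y: "l2norm (Dx L (u t)) \<le> sqrt Z" by (rule real_le_rsqrt)
    have n1R: "l1norm (u t) \<le> R1"
      using l1norm[of t] mult_left_mono[OF Y, of \<epsilon>] e unfolding R1_def by linarith
    have i: "in_L2per (\<lambda>k. \<i> * cubic (u t) k)" "in_L2per (\<lambda>k. \<i> * f k)" "in_L2per (\<lambda>k. complex_of_real \<gamma> * u t k)"
      by (intro in_L2per_scale cubic2 f u2)+
    have "l2norm (\<lambda>k. \<i> * cubic (u t) k - \<i> * f k - complex_of_real \<gamma> * u t k) \<le>
        l2norm (\<lambda>k. \<i> * cubic (u t) k) + l2norm (\<lambda>k. \<i> * f k) + l2norm (\<lambda>k. complex_of_real \<gamma> * u t k)"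
      using l2norm_triangle_diff[OF in_L2per_diff[OF i(1,2)] i(3)] l2norm_triangle_diff[OF i(1,2)] by linarith
    also have "\<dots> \<le> R1 * R1 * r + F + \<gamma> * r"
    proof -
      have "l2norm (cubic (u t)) \<le> R1 * R1 * r"
        using cubic_bound[OF u1 cubic2, of t] n1R m[of t] R10 r0
        by (meson mult_mono mult_nonneg_nonneg l1norm_nonneg l2norm_nonneg order_trans)
      then show ?thesis using g fF m[of t] unfolding l2norm_scale by (simp add: add_mono)
    qed
    finally show ?thesis
      using n1R Y R10 nf g r0 mult_nonneg_nonneg[OF mult_nonneg_nonneg[OF R10 R10] r0]
        mult_nonneg_nonneg[of \<gamma> r] real_sqrt_ge_zero[OF Z0]
      unfolding R_def by linarith
  qed
  then show ?thesis by blast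
qed

text \<open>z stands for a time derivative: a unimodular multiple of y_xx plus a remainder bounded
  in l2. B controls y_x but not y_xx, so one derivative is moved onto the other three factors. Each
  of the three resulting terms, and the one with \<rho>, keeps b or c undifferentiated in l1, which
  yields a factor \<epsilon>; hence the 4.\<close>

lemma time_derivative_term_bound:
  assumes z: "z = (\<lambda>k. \<zeta> * Dx L (Dx L y) k + \<rho> k)" "cmod \<zeta> = 1"
    and y: "in_l1 y" "in_l1 (Dx L y)" "in_L2per (Dx L (Dx L y))" "l2norm (Dx L y) \<le> B"
    and \<rho>: "in_L2per \<rho>" "l2norm \<rho> \<le> B"
    and a: "in_l1 a" "in_l1 (Dx L a)" "l1norm a \<le> B" "l2norm (Dx L a) \<le> B"
    and b: "in_l1 b" "in_l1 (Dx L b)" "l1norm b \<le> \<epsilon> * X" "l2norm (Dx L b) \<le> X"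
    and c: "in_l1 c" "in_l1 (Dx L c)" "l1norm c \<le> \<epsilon> * X" "l2norm (Dx L c) \<le> X"
    and e: "0 \<le> \<epsilon>" "\<epsilon> \<le> 1"
  shows "cmod (qform z a b c) \<le> 4 * B\<^sup>2 * \<epsilon> * X\<^sup>2"
proof -
  have X: "0 \<le> X" using b(4) l2norm_nonneg[of "Dx L b"] by linarith
  have B: "0 \<le> B" using a(3) l1norm_nonneg[of a] by linarith
  note l2 = in_l1_imp_L2per
  have "qform (Dx L (Dx L y)) a b c = - (qform (Dx L y) (Dx L a) b c + qform (Dx L y) a (Dx L b) c + qform (Dx L y) a b (Dx L c))"
    using qform_Leibniz[of L "Dx L y" a b c] y a b c
    by (simp add: qsummable1 l2 add_eq_0_iff algebra_simps)
  then have "cmod (qform (Dx L (Dx L y)) a b c) \<le> cmod (qform (Dx L y) (Dx L a) b c) + cmod (qform (Dx L y) a (Dx L b) c) + cmod (qform (Dx L y) a b (Dx L c))"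
    by (simp only: norm_minus_cancel) (intro norm_triangle_mono order_refl)
  also have "\<dots> \<le> l2norm (Dx L y) * l2norm (Dx L a) * l1norm b * l1norm c + l2norm (Dx L y) * l1norm a * l2norm (Dx L b) * l1norm c
      + l2norm (Dx L y) * l1norm a * l1norm b * l2norm (Dx L c)"
    using y a b c by (intro add_mono qform_bound12 qform_bound13 qform_bound14) (auto intro: l2)
  also have "\<dots> \<le> B * B * (\<epsilon> * X) * (\<epsilon> * X) + B * B * X * (\<epsilon> * X) + B * B * (\<epsilon> * X) * X"
    using y a b c X B e by (intro add_mono mult_mono) auto
  finally have 1: "cmod (qform (Dx L (Dx L y)) a b c) \<le> B * B * (\<epsilon> * X) * (\<epsilon> * X) + B * B * X * (\<epsilon> * X) + B * B * (\<epsilon> * X) * X" .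
  have "cmod (qform \<rho> a b c) \<le> l2norm \<rho> * l1norm a * l1norm b * l1norm c"
    by (intro qform_bound1 \<rho> a b c)
  also have "\<dots> \<le> B * B * (\<epsilon> * X) * (\<epsilon> * X)"
    using \<rho> a b c X B e by (intro mult_mono) auto
  finally have 2: "cmod (qform \<rho> a b c) \<le> B * B * (\<epsilon> * X) * (\<epsilon> * X)" .
  have "qform z a b c = \<zeta> * qform (Dx L (Dx L y)) a b c + qform \<rho> a b c"
    unfolding z using y \<rho> a b c
    by (simp add: qform_add1 qsummable1 in_L2per_scale qform_scale1)
  then have "cmod (qform z a b c) \<le> cmod (qform (Dx L (Dx L y)) a b c) + cmod (qform \<rho> a b c)"
    using z(2) by (metis mult_1 norm_mult norm_triangle_ineq)
  also have "\<dots> \<le> 2 * (B * B * (\<epsilon> * X) * (\<epsilon> * X)) + 2 * (B\<^sup>2 * \<epsilon> * X\<^sup>2)"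
    using 1 2 by (simp add: power2_eq_square algebra_simps)
  also have "B * B * (\<epsilon> * X) * (\<epsilon> * X) \<le> B\<^sup>2 * \<epsilon> * X\<^sup>2"
  proof -
    have "B\<^sup>2 * X\<^sup>2 * \<epsilon> * \<epsilon> \<le> B\<^sup>2 * X\<^sup>2 * \<epsilon> * 1"
      using e by (intro mult_left_mono) auto
    then show ?thesis by (simp add: power2_eq_square mult_ac)
  qed
  finally show ?thesis by (simp add: mult_ac)
qed

section \<open>Difference of two trajectories\<close>

lemma Dx_star: "Dx L (star c) = (\<lambda>k. - star (Dx L c) k)"
  using star_Dx[of L c] by simp

lemma in_l1_Dx_star [simp]: "in_l1 (Dx L (star c)) = in_l1 (Dx L c)"
  unfolding Dx_star using in_l1_star[of "Dx L c"] by (simp add: in_l1_def)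

lemma l2norm_Dx_star [simp]: "l2norm (Dx L (star c)) = l2norm (Dx L c)"
  unfolding Dx_star by simp

lemma star_DDx: "star (Dx L (Dx L c)) = Dx L (Dx L (star c))"
  unfolding star_def Dx_def wavenum_def by simp

text \<open>On functions, |u|^2 u - |v|^2 v = (|u|^2 + |v|^2) w + u v conj(w). Replacing factors one
  at a time would create coefficients of w such as v conj(u). Here they are real, so the operator
  acting on w is symmetric for \<open>rinner\<close> and possesses a quadratic energy.\<close>

lemma cubic_diff_qform:
  assumes u: "in_l1 u" and v: "in_l1 v" and z: "in_L2per z"
  defines "w \<equiv> (\<lambda>k. u k - v k)"
  shows "qform u u (star u) z - qform v v (star v) z =
    qform u (star u) w z + qform v (star v) w z + qform u v (star w) z"
proof -
  have w: "star w = (\<lambda>k. star u k - star v k)" unfolding w_def by (rule star_diff)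
  have 1: "qform u (star u) w z = qform u (star u) u z - qform u (star u) v z"
    unfolding w_def using u v z by (intro qform_diff3 qsummable4) auto
  have 2: "qform v (star v) w z = qform v (star v) u z - qform v (star v) v z"
    unfolding w_def using u v z by (intro qform_diff3 qsummable4) auto
  have 3: "qform u v (star w) z = qform u v (star u) z - qform u v (star v) z"
    unfolding w using u v z by (intro qform_diff3 qsummable4) auto
  have "qform u (star u) u z = qform u u (star u) z" "qform u (star u) v z = qform u v (star u) z"
    "qform v (star v) v z = qform v v (star v) z"
    by (rule qform_swap23)+
  moreover have "qform v (star v) u z = qform u v (star v) z" by (rule qform_rot3)
  ultimately show ?thesis unfolding 1 2 3 by simp
qed

text \<open>The thresholds on \<epsilon> count terms. Three forms in \<open>N\<close>, each at most
  B^2 \<epsilon>^2 X^2, must stay below X^2 / 2; six forms in \<open>R\<close>, each at most 4 B^2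
  \<epsilon> X^2, must stay below \<gamma> X^2 / 2.\<close>

lemma trajectories_coincide:
  assumes U: "nls_trajectory L \<gamma> f u ut" and V: "nls_trajectory L \<gamma> f v vt"
    and Ub: "\<And>t. l1norm (u t) \<le> B" "\<And>t. l2norm (Dx L (u t)) \<le> B"
      "\<And>t. l2norm (\<lambda>k. \<i> * cubic (u t) k - \<i> * f k - complex_of_real \<gamma> * u t k) \<le> B"
    and Vb: "\<And>t. l1norm (v t) \<le> B" "\<And>t. l2norm (Dx L (v t)) \<le> B"
      "\<And>t. l2norm (\<lambda>k. \<i> * cubic (v t) k - \<i> * f k - complex_of_real \<gamma> * v t k) \<le> B"
    and W: "\<And>t. l1norm (\<lambda>k. u t k - v t k) \<le> \<epsilon> * l2norm (Dx L (\<lambda>k. u t k - v t k))"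
    and e: "0 \<le> \<epsilon>" "\<epsilon> \<le> 1" "6 * B\<^sup>2 * \<epsilon> \<le> 1" "48 * B\<^sup>2 * \<epsilon> \<le> \<gamma>"
  shows "u t = v t"
proof -
  interpret U: nls_trajectory L \<gamma> f u ut by (rule U)
  interpret V: nls_trajectory L \<gamma> f v vt by (rule V)
  define w where "w s = (\<lambda>k. u s k - v s k)" for s
  define wt where "wt s = (\<lambda>k. ut s k - vt s k)" for s
  define X where "X s = l2norm (Dx L (w s))" for s
  have W: "l1norm (w s) \<le> \<epsilon> * X s" for s using W[of s] unfolding w_def X_def .
  have B: "0 \<le> B" using Ub(1)[of 0] l1norm_nonneg[of "u 0"] by linarith
  have Dw: "Dx L (w s) = (\<lambda>k. Dx L (u s) k - Dx L (v s) k)" for s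
    unfolding w_def by (rule Dx_diff)
  have DDw: "Dx L (Dx L (w s)) = (\<lambda>k. Dx L (Dx L (u s)) k - Dx L (Dx L (v s)) k)" for s
    unfolding Dw by (rule Dx_diff)
  have w1: "in_l1 (w s)" for s unfolding w_def by (intro in_l1_diff U.u1 V.u1)
  have w2: "in_L2per (w s)" for s by (rule in_l1_imp_L2per[OF w1])
  have Dw1: "in_l1 (Dx L (w s))" for s unfolding Dw by (intro in_l1_diff U.Du1 V.Du1)
  have DDw2: "in_L2per (Dx L (Dx L (w s)))" for s unfolding DDw by (intro in_L2per_diff U.DDu2 V.DDu2)
  have wt2: "in_L2per (wt s)" for s unfolding wt_def by (intro in_L2per_diff U.ut2 V.ut2)
  have w_cont: "l1_cont w s" for s unfolding w_def by (intro l1_cont_diff U.cont V.cont)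
  have w_DD_cont: "l2_cont (\<lambda>s. Dx L (Dx L (w s))) s" for s
    unfolding DDw by (intro l2_cont_diff U.DD_cont V.DD_cont)
  have w_deriv: "l2_deriv w (wt s) s" for s
    unfolding w_def wt_def by (intro l2_deriv_diff U.deriv V.deriv U.u2 V.u2)

  \<comment> \<open>Half the gradient of \<open>H\<close> in w. The force cancels in the difference,
    so w_t = - i G - \<gamma> w has no inhomogeneity, and Gronwall can later be applied with
    constant 0.\<close>
  define G where "G s = (\<lambda>k. Dx L (Dx L (w s)) k - (cubic (u s) k - cubic (v s) k))" for s
  have G2: "in_L2per (G s)" for s
    unfolding G_def by (intro in_L2per_diff DDw2 U.cubic2 V.cubic2)
  have wt_eq: "wt s = (\<lambda>k. - (\<i> * G s k) - complex_of_real \<gamma> * w s k)" for s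
    unfolding wt_def G_def DDw U.eq[of s] V.eq[of s] unfolding w_def by (simp add: algebra_simps)
  \<comment> \<open>The pairing of the cubic difference with z. With u and v frozen it is a
    symmetric form in w and z, and its value at z = w corrects |w_x|^2 in \<open>H\<close>.\<close>
  define N where "N s z = Re (qform (u s) (star (u s)) (w s) (star z)) + Re (qform (v s) (star (v s)) (w s) (star z))
    + Re (qform (u s) (v s) (star (w s)) (star z))" for s z
  have rinner_G: "rinner (G s) z = rinner (Dx L (Dx L (w s))) z - N s z" if "in_L2per z" for s z
  proof -
    have "rinner (cubic (u s)) z - rinner (cubic (v s)) z = N s z"
      using cubic_diff_qform[of "u s" "v s" "star z"] that
      unfolding N_def w_def by (simp add: qform_cubic U.u1 V.u1 flip: minus_complex.simps(1) plus_complex.simps(1))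
    then show ?thesis
      unfolding G_def using that by (simp add: rinner_diff_left in_L2per_diff DDw2 U.cubic2 V.cubic2)
  qed
  have rinner_G_wt: "rinner (G s) (wt s) = - \<gamma> * rinner (G s) (w s)" for s
  proof -
    have "rinner (G s) (wt s) = rinner (G s) (\<lambda>k. - (\<i> * G s k)) - rinner (G s) (\<lambda>k. complex_of_real \<gamma> * w s k)"
      unfolding wt_eq by (intro rinner_diff_right G2 in_L2per_uminus in_L2per_scale w2)
    moreover have "rinner (G s) (\<lambda>k. - (\<i> * G s k)) = 0"
      unfolding rinner_commute[of "G s"] rinner_uminus_left unfolding rinner_commute[of _ "G s"] by (simp add: rinner_i_self)
    ultimately show ?thesis by (simp add: rinner_scale_right)
  qed

  define H where "H s = rinner (Dx L (Dx L (w s))) (w s) - N s (w s)" for s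
  \<comment> \<open>The contributions in which the time derivative falls on the coefficients u and v
    instead of on w; they arise because the quadratic form itself varies in time.\<close>
  define R where "R s =
      Re (qform (ut s) (star (u s)) (w s) (star (w s))) + Re (qform (u s) (star (ut s)) (w s) (star (w s)))
    + Re (qform (vt s) (star (v s)) (w s) (star (w s))) + Re (qform (v s) (star (vt s)) (w s) (star (w s)))
    + Re (qform (ut s) (v s) (star (w s)) (star (w s))) + Re (qform (u s) (vt s) (star (w s)) (star (w s)))" for s
  have H_eq: "H s = (X s)\<^sup>2 - N s (w s)" for s
    unfolding H_def X_def by (simp add: rinner_DDx_self)

  have N_deriv: "((\<lambda>s. N s (w s)) has_real_derivative 2 * N s (wt s) + R s) (at s)" for s
  proof -
    note c = U.cont[of s] l1_cont_star[OF U.cont[of s]] V.cont[of s] l1_cont_star[OF V.cont[of s]]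
      w_cont[of s] l1_cont_star[OF w_cont[of s]]
    note d = U.deriv[of s] l2_deriv_star[OF U.deriv[of s]] V.deriv[of s] l2_deriv_star[OF V.deriv[of s]]
      w_deriv[of s] l2_deriv_star[OF w_deriv[of s]]
    \<comment> \<open>The coefficient |a|^2 is real, so differentiating either copy of w gives the
      same real part. This produces the factor 2 in front of \<open>N s (wt s)\<close>, which then
      combines with the derivative of |w_x|^2 into 2 \<open>rinner (G s) (wt s)\<close>.\<close>
    have sym: "Re (qform a (star a) (wt s) (star (w s))) = Re (qform a (star a) (w s) (star (wt s)))" for a
    proof -
      have "cnj (qform a (star a) (wt s) (star (w s))) = qform (star a) a (star (wt s)) (w s)"
        using qform_star[of a "star a" "wt s" "star (w s)"] by simp
      also have "\<dots> = qform a (star a) (w s) (star (wt s))"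
        by (metis qform_swap12 qform_swap34)
      finally show ?thesis by (metis cnj.simps(1))
    qed
    have sym2: "qform (u s) (v s) (star (wt s)) (star (w s)) = qform (u s) (v s) (star (w s)) (star (wt s))"
      by (rule qform_swap34)
    have "((\<lambda>s. N s (w s)) has_real_derivative
      (Re (qform (ut s) (star (u s)) (w s) (star (w s))) + Re (qform (u s) (star (ut s)) (w s) (star (w s)))
        + Re (qform (u s) (star (u s)) (wt s) (star (w s))) + Re (qform (u s) (star (u s)) (w s) (star (wt s))))
      + (Re (qform (vt s) (star (v s)) (w s) (star (w s))) + Re (qform (v s) (star (vt s)) (w s) (star (w s)))
        + Re (qform (v s) (star (v s)) (wt s) (star (w s))) + Re (qform (v s) (star (v s)) (w s) (star (wt s))))
      + (Re (qform (ut s) (v s) (star (w s)) (star (w s))) + Re (qform (u s) (vt s) (star (w s)) (star (w s)))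
        + Re (qform (u s) (v s) (star (wt s)) (star (w s))) + Re (qform (u s) (v s) (star (w s)) (star (wt s))))) (at s)"
      unfolding N_def
      by (rule DERIV_add[OF DERIV_add[OF qform_deriv[OF c(1,2,5,6) d(1,2,5,6)] qform_deriv[OF c(3,4,5,6) d(3,4,5,6)]]
            qform_deriv[OF c(1,3,6,6) d(1,3,6,6)]])
    then show ?thesis
      by (rule DERIV_cong) (simp add: sym sym2 N_def R_def)
  qed
  have H_deriv: "(H has_real_derivative - 2 * \<gamma> * H s - R s) (at s)" for s
  proof -
    have "(H has_real_derivative 2 * rinner (Dx L (Dx L (w s))) (wt s) - (2 * N s (wt s) + R s)) (at s)"
      unfolding H_def[abs_def]
      by (intro DERIV_diff Dx_energy_deriv N_deriv l1_cont_imp_l2_cont w_cont w_DD_cont w_deriv)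
    moreover have "2 * rinner (Dx L (Dx L (w s))) (wt s) - (2 * N s (wt s) + R s) = 2 * rinner (G s) (wt s) - R s"
      unfolding rinner_G[OF wt2] by simp
    moreover have "\<dots> = - 2 * \<gamma> * H s - R s"
      unfolding rinner_G_wt rinner_G[OF w2] H_def by simp
    ultimately show ?thesis by simp
  qed

  have N_bound: "\<bar>N s (w s)\<bar> \<le> (X s)\<^sup>2 / 2" for s
  proof -
    have X0: "0 \<le> X s" unfolding X_def by simp
    have n2w: "l2norm (w s) \<le> \<epsilon> * X s" using l2norm_le_l1norm[OF w1] W by (rule order_trans)
    have t: "\<bar>Re (qform a b c d)\<bar> \<le> B * B * (\<epsilon> * X s) * (\<epsilon> * X s)"
      if "in_l1 a" "in_l1 b" "l1norm a \<le> B" "l1norm b \<le> B" "c = w s \<or> c = star (w s)" "d = w s \<or> d = star (w s)" for a b c d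
    proof -
      have c: "in_L2per c" "l2norm c \<le> \<epsilon> * X s" "in_L2per d" "l2norm d \<le> \<epsilon> * X s"
        using that w2 n2w by auto
      have "\<bar>Re (qform a b c d)\<bar> \<le> l1norm a * l1norm b * l2norm c * l2norm d"
        using that c by (intro order_trans[OF abs_Re_le_cmod] qform_summable_bound)
      also have "\<dots> \<le> B * B * (\<epsilon> * X s) * (\<epsilon> * X s)"
        using that c B e X0 by (intro mult_mono) auto
      finally show ?thesis .
    qed
    have "\<bar>N s (w s)\<bar> \<le> 3 * (B * B * (\<epsilon> * X s) * (\<epsilon> * X s))"
      unfolding N_def
      using t[of "u s" "star (u s)" "w s" "star (w s)"] t[of "v s" "star (v s)" "w s" "star (w s)"]
        t[of "u s" "v s" "star (w s)" "star (w s)"] U.u1[of s] V.u1[of s] Ub(1)[of s] Vb(1)[of s]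
      by simp
    also have "\<dots> = (6 * B\<^sup>2 * \<epsilon>) * \<epsilon> * (X s)\<^sup>2 / 2" by (simp add: power2_eq_square)
    also have "\<dots> \<le> 1 * 1 * (X s)\<^sup>2 / 2"
      using e by (intro divide_right_mono mult_right_mono mult_mono) auto
    finally show ?thesis by simp
  qed

  have R_bound: "\<bar>R s\<bar> \<le> \<gamma> * (X s)\<^sup>2 / 2" for s
  proof -
    have d: "\<bar>Re (qform z a (w s) (star (w s)))\<bar> \<le> 4 * B\<^sup>2 * \<epsilon> * (X s)\<^sup>2 \<and>
        \<bar>Re (qform z a (star (w s)) (star (w s)))\<bar> \<le> 4 * B\<^sup>2 * \<epsilon> * (X s)\<^sup>2"
      if "z = (\<lambda>k. \<zeta> * Dx L (Dx L y) k + \<rho> k)" "cmod \<zeta> = 1"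
        "in_l1 y" "in_l1 (Dx L y)" "in_L2per (Dx L (Dx L y))" "l2norm (Dx L y) \<le> B"
        "in_L2per \<rho>" "l2norm \<rho> \<le> B" "in_l1 a" "in_l1 (Dx L a)" "l1norm a \<le> B" "l2norm (Dx L a) \<le> B" for z a \<zeta> y \<rho>
    proof -
      have "l2norm (Dx L (w s)) \<le> X s" by (simp add: X_def)
      then show ?thesis
        using time_derivative_term_bound[OF that, of "w s" \<epsilon> "X s" "star (w s)"]
          time_derivative_term_bound[OF that, of "star (w s)" \<epsilon> "X s" "star (w s)"]
        by (simp add: w1 Dw1 W e order_trans[OF abs_Re_le_cmod])
    qed
    define \<rho> where "\<rho> x s = (\<lambda>k. \<i> * cubic (x s) k - \<i> * f k - complex_of_real \<gamma> * x s k)" for x :: "real \<Rightarrow> fcoef" and s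
    have \<rho>u: "in_L2per (\<rho> u s)" "l2norm (\<rho> u s) \<le> B"
      unfolding \<rho>_def using Ub(3) by (auto intro!: in_L2per_diff U.cubic2 U.f U.u2)
    have \<rho>v: "in_L2per (\<rho> v s)" "l2norm (\<rho> v s) \<le> B"
      unfolding \<rho>_def using Vb(3) by (auto intro!: in_L2per_diff V.cubic2 V.f V.u2)
    have zu: "ut s = (\<lambda>k. - \<i> * Dx L (Dx L (u s)) k + \<rho> u s k)"
      unfolding U.eq[of s] \<rho>_def by (simp add: algebra_simps)
    have zv: "vt s = (\<lambda>k. - \<i> * Dx L (Dx L (v s)) k + \<rho> v s k)"
      unfolding V.eq[of s] \<rho>_def by (simp add: algebra_simps)
    \<comment> \<open>Conjugation turns the factor - i of the second derivative into i; the bound is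
      stated for any unimodular \<zeta> so as to cover both signs.\<close>
    have zus: "star (ut s) = (\<lambda>k. \<i> * Dx L (Dx L (star (u s))) k + star (\<rho> u s) k)"
      unfolding zu star_DDx[symmetric] by (simp add: star_def add.commute)
    have zvs: "star (vt s) = (\<lambda>k. \<i> * Dx L (Dx L (star (v s))) k + star (\<rho> v s) k)"
      unfolding zv star_DDx[symmetric] by (simp add: star_def add.commute)
    note U1 = U.u1[of s] U.Du1[of s] U.DDu2[of s] Ub(1,2)[of s] \<rho>u
    note V1 = V.u1[of s] V.Du1[of s] V.DDu2[of s] Vb(1,2)[of s] \<rho>v
    have DDs: "in_L2per (Dx L (Dx L (star (u s))))" "in_L2per (Dx L (Dx L (star (v s))))"
      using U.DDu2[of s] V.DDu2[of s] by (simp_all flip: star_DDx)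
    have r: "\<bar>Re (qform (ut s) (star (u s)) (w s) (star (w s)))\<bar> \<le> 4 * B\<^sup>2 * \<epsilon> * (X s)\<^sup>2"
      "\<bar>Re (qform (star (ut s)) (u s) (w s) (star (w s)))\<bar> \<le> 4 * B\<^sup>2 * \<epsilon> * (X s)\<^sup>2"
      "\<bar>Re (qform (vt s) (star (v s)) (w s) (star (w s)))\<bar> \<le> 4 * B\<^sup>2 * \<epsilon> * (X s)\<^sup>2"
      "\<bar>Re (qform (star (vt s)) (v s) (w s) (star (w s)))\<bar> \<le> 4 * B\<^sup>2 * \<epsilon> * (X s)\<^sup>2"
      "\<bar>Re (qform (ut s) (v s) (star (w s)) (star (w s)))\<bar> \<le> 4 * B\<^sup>2 * \<epsilon> * (X s)\<^sup>2"
      "\<bar>Re (qform (vt s) (u s) (star (w s)) (star (w s)))\<bar> \<le> 4 * B\<^sup>2 * \<epsilon> * (X s)\<^sup>2"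
      using d[OF zu, of "star (u s)"] d[OF zus, of "u s"] d[OF zv, of "star (v s)"] d[OF zvs, of "v s"]
        d[OF zu, of "v s"] d[OF zv, of "u s"] U1 V1 DDs by simp_all
    have "\<bar>R s\<bar> \<le> 24 * B\<^sup>2 * \<epsilon> * (X s)\<^sup>2"
      unfolding R_def qform_swap12[of "u s" "star (ut s)"] qform_swap12[of "v s" "star (vt s)"] qform_swap12[of "u s" "vt s"]
      using r by linarith
    also have "\<dots> = (48 * B\<^sup>2 * \<epsilon>) * (X s)\<^sup>2 / 2" by simp
    also have "\<dots> \<le> \<gamma> * (X s)\<^sup>2 / 2"
      using e by (intro divide_right_mono mult_right_mono) auto
    finally show ?thesis .
  qed

  \<comment> \<open>\<open>N_bound\<close> gives H \<ge> X^2 / 2, so the bound on \<open>R\<close>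
    is at most \<gamma> H and half of the damping is left. A bounded quantity that decays like this
    on the whole line cannot be positive, while H dominates X^2 / 2.\<close>
  have "H s \<le> 0 / \<gamma>" for s
  proof (rule backward_Gronwall[OF U.\<gamma> H_deriv])
    fix s
    have "(X s)\<^sup>2 / 2 \<le> H s" using N_bound[of s] unfolding H_eq by linarith
    then have "\<gamma> * ((X s)\<^sup>2 / 2) \<le> \<gamma> * H s" using U.\<gamma> by simp
    then show "- 2 * \<gamma> * H s - R s \<le> - \<gamma> * H s + 0"
      using R_bound[of s] by simp
  next
    fix s
    have "X s \<le> 2 * B"
      unfolding X_def Dw using l2norm_triangle_diff[OF U.Du2[of s] V.Du2[of s]] Ub(2)[of s] Vb(2)[of s] by linarith
    then have "(X s)\<^sup>2 \<le> (2 * B)\<^sup>2" by (rule power_mono) (simp add: X_def)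
    then show "H s \<le> 2 * (2 * B)\<^sup>2" using N_bound[of s] zero_le_power2[of "2 * B"] unfolding H_eq by linarith
  qed
  from this[of t] have "(X t)\<^sup>2 - N t (w t) \<le> 0" by (simp add: H_eq)
  with N_bound[of t] have "(X t)\<^sup>2 \<le> 0" by linarith
  then have "X t = 0" by simp
  then have "l2norm (w t) \<le> 0" using W[of t] l2norm_le_l1norm[OF w1, of t] by simp
  then have "w t k = 0" for k using l2norm_eq_0[OF w2, of t k] l2norm_nonneg[of "w t"] by simp
  then show ?thesis by (auto simp: w_def)
qed

section \<open>From trajectories in the attractor to the coefficient setting\<close>

lemma L2norm_l2norm: "L2norm L c = sqrt L * l2norm c"
  unfolding L2norm_def l2norm_def by (simp add: real_sqrt_mult)

lemma l2norm_dxx: "l2norm (dxx L c) = l2norm (Dx L (Dx L c))"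
  unfolding dxx_Dx by simp

lemma in_L2per_dxx: "in_L2per (dxx L c) = in_L2per (Dx L (Dx L c))"
  unfolding dxx_Dx in_L2per_def by simp

lemma in_H2per_iff: "in_H2per L c \<longleftrightarrow> in_L2per c \<and> in_L2per (Dx L (Dx L c))"
  unfolding in_H2per_def in_L2per_dxx ..

lemma l2norm_le_H2norm:
  assumes "0 < L"
  shows "l2norm c \<le> H2norm L c / sqrt L" "l2norm (Dx L (Dx L c)) \<le> H2norm L c / sqrt L"
proof -
  have "sqrt L * l2norm c \<le> H2norm L c" "sqrt L * l2norm (Dx L (Dx L c)) \<le> H2norm L c"
    unfolding H2norm_def L2norm_l2norm l2norm_dxx by (auto intro!: real_le_rsqrt)
  then show "l2norm c \<le> H2norm L c / sqrt L" "l2norm (Dx L (Dx L c)) \<le> H2norm L c / sqrt L"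
    using assms by (simp_all add: field_simps)
qed

text \<open>A sequence whose n-th norm exceeds n has no subsequence that stays near a limit, because
  a strictly increasing selection satisfies \<open>r n\<close> \<ge> n.\<close>

lemma H2_compact_bounded:
  assumes L: "0 < L" and A: "H2_compact L A"
  shows "\<exists>B. \<forall>c\<in>A. l2norm c + l2norm (Dx L (Dx L c)) \<le> B"
proof (rule ccontr)
  let ?h = "\<lambda>c. l2norm c + l2norm (Dx L (Dx L c))"
  assume "\<not> ?thesis"
  then have "\<forall>n::nat. \<exists>c\<in>A. real n < ?h c" by (meson not_le)
  then obtain s where s: "\<And>n. s n \<in> A" "\<And>n. real n < ?h (s n)" by metis
  obtain r b where r: "strict_mono r" "b \<in> A" "(\<lambda>n. H2norm L (\<lambda>k. s (r n) k - b k)) \<longlonglongrightarrow> 0"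
    using A s(1) unfolding H2_compact_def by blast
  have inH: "in_L2per c" "in_L2per (Dx L (Dx L c))" if "c \<in> A" for c
    using A that unfolding H2_compact_def in_H2per_iff by auto
  have "\<forall>\<^sub>F n in sequentially. H2norm L (\<lambda>k. s (r n) k - b k) < 1"
    using order_tendstoD(2)[OF r(3), of 1] by simp
  then obtain N where N: "\<And>n. n \<ge> N \<Longrightarrow> H2norm L (\<lambda>k. s (r n) k - b k) < 1"
    by (auto simp: eventually_sequentially)
  obtain M :: nat where M: "?h b + 2 / sqrt L \<le> real M" using real_arch_simple by blast
  define n where "n = max N M"
  let ?d = "\<lambda>k. s (r n) k - b k"
  have "l2norm (s (r n)) \<le> l2norm b + l2norm ?d"
    by (intro l2norm_triangle_sub inH s r)
  moreover have "l2norm (Dx L (Dx L (s (r n)))) \<le> l2norm (Dx L (Dx L b)) + l2norm (Dx L (Dx L ?d))"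
    unfolding Dx_diff by (intro l2norm_triangle_sub inH s r)
  moreover have "H2norm L ?d / sqrt L \<le> 1 / sqrt L"
    using N[of n] L by (intro divide_right_mono) (auto simp: n_def)
  ultimately have "?h (s (r n)) \<le> ?h b + 2 / sqrt L"
    using l2norm_le_H2norm[OF L, of ?d] by simp
  also have "\<dots> \<le> real (r n)"
    using M strict_mono_imp_increasing[OF r(1), of n] by (simp add: n_def)
  finally show False using s(2)[of "r n"] by simp
qed

lemma complete_trajectory_is_nls_trajectory:
  assumes L: "0 < L" and g: "0 < \<gamma>" and f: "in_L2per f" and A: "H2_compact L A"
    and u: "complete_trajectory_in L \<gamma> f A u"
  obtains ut where "nls_trajectory L \<gamma> f u ut"
proof -
  have sol: "is_nls_solution L \<gamma> f UNIV u" and uA: "\<And>t. u t \<in> A"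
    using u unfolding complete_trajectory_in_def by auto
  have u2: "in_L2per (u t)" and DD2: "in_L2per (Dx L (Dx L (u t)))" for t
    using sol unfolding is_nls_solution_def in_H2per_iff by auto
  have lim: "((\<lambda>h. H2norm L (\<lambda>k. u (t + h) k - u t k)) \<longlongrightarrow> 0) (at 0)" for t
    using sol LIM_offset_zero[of "\<lambda>s. H2norm L (\<lambda>k. u s k - u t k)" 0 t]
    unfolding is_nls_solution_def by simp
  have "\<exists>ut. \<forall>t. in_L2per (ut t) \<and>
      ((\<lambda>h. L2norm L (\<lambda>k. (u (t + h) k - u t k) / complex_of_real h - ut t k)) \<longlongrightarrow> 0) (at 0) \<and>
      (\<forall>k. \<i> * ut t k + dxx L (u t) k + cubic (u t) k + \<i> * complex_of_real \<gamma> * u t k = f k)"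
    using sol unfolding is_nls_solution_def by simp
  then obtain ut where ut2: "\<And>t. in_L2per (ut t)"
    and dlim: "\<And>t. ((\<lambda>h. L2norm L (\<lambda>k. (u (t + h) k - u t k) / complex_of_real h - ut t k)) \<longlongrightarrow> 0) (at 0)"
    and eq: "\<And>t k. \<i> * ut t k + dxx L (u t) k + cubic (u t) k + \<i> * complex_of_real \<gamma> * u t k = f k"
    by blast
  obtain C where C: "\<And>c. in_L2per c \<Longrightarrow> in_L2per (Dx L c) \<Longrightarrow> in_l1 c \<and> l1norm c \<le> C * l2norm c + 1 * l2norm (Dx L c)"
    and C0: "0 \<le> C"
    using l1norm_interpolation[OF L zero_less_one] by blast
  have D2: "in_L2per (Dx L (u t))" for t by (rule in_L2per_Dx[OF u2 DD2])
  have u1: "in_l1 (u t)" for t using C[OF u2 D2] by blast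
  have limle: "((\<lambda>h. p h) \<longlongrightarrow> 0) (at 0)" if "\<And>h. 0 \<le> p h" "\<And>h. p h \<le> K * (H2norm L (\<lambda>k. u (t + h) k - u t k) / sqrt L)" for p K t
  proof (rule Lim_null_comparison)
    show "((\<lambda>h. K * (H2norm L (\<lambda>k. u (t + h) k - u t k) / sqrt L)) \<longlongrightarrow> 0) (at 0)"
      using tendsto_mult_left[OF tendsto_divide[OF lim[of t] tendsto_const[of "sqrt L"]], of K] L by simp
  qed (use that in auto)
  have "nls_trajectory L \<gamma> f u ut"
  proof
    fix t
    show "in_l1 (u t)" by (rule u1)
    \<comment> \<open>Applied to u_x in place of u, the interpolation spends the second derivative.
      Summability of u_x in l1 makes the integrations by parts absolutely convergent.\<close>
    show "in_l1 (Dx L (u t))" using C[OF D2 DD2] by blast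
    \<comment> \<open>Solving the equation for the cubic term shows it to be in L2, since all other
      terms are; no product estimate is involved.\<close>
    have cub: "cubic (u t) = (\<lambda>k. f k - \<i> * ut t k + Dx L (Dx L (u t)) k - \<i> * complex_of_real \<gamma> * u t k)"
      using eq[of t] by (auto simp: dxx_Dx algebra_simps fun_eq_iff)
    show "in_L2per (cubic (u t))"
      unfolding cub by (intro in_L2per_diff in_L2per_add in_L2per_scale f ut2 DD2 u2)
    show "l1_cont u t"
      unfolding l1_cont_def
    proof (intro conjI allI u1)
      \<comment> \<open>In the factor C + 2, C belongs to the l2 norm in the interpolation, and 2 to
        bounding the first derivative by the function plus its second derivative.\<close>
      show "((\<lambda>h. l1norm (\<lambda>k. u (t + h) k - u t k)) \<longlongrightarrow> 0) (at 0)"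
      proof (rule limle[where K = "C + 2"])
        fix h
        let ?d = "\<lambda>k. u (t + h) k - u t k"
        have d: "in_L2per ?d" "in_L2per (Dx L (Dx L ?d))"
          unfolding Dx_diff by (intro in_L2per_diff u2 DD2)+
        note Dd = in_L2per_Dx[OF d]
        have "l1norm ?d \<le> C * l2norm ?d + l2norm (Dx L ?d)" using C[OF d(1) Dd(1)] by simp
        also have "\<dots> \<le> C * l2norm ?d + (l2norm ?d + l2norm (Dx L (Dx L ?d)))" using Dd(2) by simp
        also have "\<dots> \<le> C * (H2norm L ?d / sqrt L) + (H2norm L ?d / sqrt L + H2norm L ?d / sqrt L)"
          by (intro add_mono mult_left_mono l2norm_le_H2norm L C0)
        finally show "l1norm ?d \<le> (C + 2) * (H2norm L ?d / sqrt L)" by (simp only: distrib_right mult_2)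
      qed simp
    qed
    show "l2_cont (\<lambda>s. Dx L (Dx L (u s))) t"
      unfolding l2_cont_def
    proof (intro conjI allI DD2)
      show "((\<lambda>h. l2norm (\<lambda>k. Dx L (Dx L (u (t + h))) k - Dx L (Dx L (u t)) k)) \<longlongrightarrow> 0) (at 0)"
        by (rule limle[where K = 1 and t = t]) (use l2norm_le_H2norm(2)[OF L, of "\<lambda>k. u (t + _) k - u t k"] in \<open>simp_all add: Dx_diff\<close>)
    qed
    show "l2_deriv u (ut t) t"
      unfolding l2_deriv_def
    proof (intro conjI ut2)
      have "((\<lambda>h. L2norm L (\<lambda>k. (u (t + h) k - u t k) / complex_of_real h - ut t k) / sqrt L) \<longlongrightarrow> 0 / sqrt L) (at 0)"
        using L by (intro tendsto_divide dlim) auto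
      then show "((\<lambda>h. l2norm (\<lambda>k. (u (t + h) k - u t k) / complex_of_real h - ut t k)) \<longlongrightarrow> 0) (at 0)"
        using L by (simp add: L2norm_l2norm)
    qed
    have "ut t k = - \<i> * (Dx L (Dx L (u t)) k - cubic (u t) k + f k) - complex_of_real \<gamma> * u t k" for k
      unfolding cub by (simp add: algebra_simps)
    then show "ut t = (\<lambda>k. - \<i> * (Dx L (Dx L (u t)) k - cubic (u t) k + f k) - complex_of_real \<gamma> * u t k)"
      by blast
    obtain B where B: "\<And>c. c \<in> A \<Longrightarrow> l2norm c + l2norm (Dx L (Dx L c)) \<le> B"
      using H2_compact_bounded[OF L A] by blast
    have "l2norm (u t) \<le> B \<and> l2norm (Dx L (u t)) \<le> B" for t
      using B[OF uA, of t] in_L2per_Dx(2)[OF u2 DD2, of t] l2norm_nonneg[of "Dx L (Dx L (u t))"] by linarith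
    then show "\<exists>B. \<forall>t. l2norm (u t) \<le> B \<and> l2norm (Dx L (u t)) \<le> B" by blast
  qed (use L g f DD2 in auto)
  then show ?thesis by (rule that)
qed

section \<open>Choice of the constant\<close>

lemma determining_modes:
  fixes L \<gamma> nf :: real
  shows "\<exists>K>0. \<forall>f A (m::nat) u1 u2.
       0 < L \<longrightarrow> 0 < \<gamma> \<longrightarrow> in_L2per f \<longrightarrow> L2norm L f = nf \<longrightarrow> H2_compact L A \<longrightarrow>
       real m \<ge> L / (2 * pi) * K - 1 \<longrightarrow>
       complete_trajectory_in L \<gamma> f A u1 \<longrightarrow> complete_trajectory_in L \<gamma> f A u2 \<longrightarrow>
       (\<forall>t. proj m (u1 t) = proj m (u2 t)) \<longrightarrow> (\<forall>t. u1 t = u2 t)"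
proof (cases "0 < L \<and> 0 < \<gamma> \<and> 0 \<le> nf")
  \<comment> \<open>Any positive K serves for inadmissible parameters, where the claim is vacuous (a
    negative nf is not a norm). A value is still required, as the constant is to be a total positive
    function.\<close>
  case False
  have "0 \<le> L2norm L f" if "0 < L" for f
    using that by (simp add: L2norm_l2norm)
  with False show ?thesis by (intro exI[of _ 1]) auto
next
  case True
  then have L: "0 < L" and g: "0 < \<gamma>" and nf: "0 \<le> nf / sqrt L" by auto
  obtain R where R: "\<And>f u ut t. nls_trajectory L \<gamma> f u ut \<Longrightarrow> l2norm f \<le> nf / sqrt L \<Longrightarrow>
    l1norm (u t) \<le> R \<and> l2norm (Dx L (u t)) \<le> R \<and> l2norm (\<lambda>k. \<i> * cubic (u t) k - \<i> * f k - complex_of_real \<gamma> * u t k) \<le> R"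
    using nls_trajectory_uniform_bound[OF L g nf] by blast
  \<comment> \<open>The three entries of the minimum answer the three upper bounds on \<epsilon> in
    \<open>trajectories_coincide\<close>; the added 1 keeps the denominators positive when R =
    0.\<close>
  define \<epsilon> where "\<epsilon> = min 1 (min (1 / (6 * R\<^sup>2 + 1)) (\<gamma> / (48 * R\<^sup>2 + 1)))"
  have p: "0 < 6 * R\<^sup>2 + 1" "0 < 48 * R\<^sup>2 + 1"
    by (auto intro: add_nonneg_pos)
  have e: "0 < \<epsilon>" "\<epsilon> \<le> 1" unfolding \<epsilon>_def using p g by auto
  have "\<epsilon> \<le> 1 / (6 * R\<^sup>2 + 1)" "\<epsilon> \<le> \<gamma> / (48 * R\<^sup>2 + 1)" unfolding \<epsilon>_def by auto
  then have "\<epsilon> * (6 * R\<^sup>2 + 1) \<le> 1" "\<epsilon> * (48 * R\<^sup>2 + 1) \<le> \<gamma>"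
    using p by (simp_all add: pos_le_divide_eq)
  then have e': "6 * R\<^sup>2 * \<epsilon> \<le> 1" "48 * R\<^sup>2 * \<epsilon> \<le> \<gamma>"
    using e(1) by (simp_all add: algebra_simps)
  obtain N :: nat where N: "\<And>m c. N \<le> m \<Longrightarrow> in_L2per (Dx L c) \<Longrightarrow> (\<forall>k. \<bar>k\<bar> \<le> int m \<longrightarrow> c k = 0) \<Longrightarrow>
    l1norm c \<le> \<epsilon> * l2norm (Dx L c)"
    using high_mode_bound[OF L e(1)] by blast
  \<comment> \<open>The witness is the wavenumber of mode N + 1, for which
    \<open>L / (2 * pi) * K - 1\<close> equals N; the condition on m then says exactly that
    \<open>high_mode_bound\<close> applies.\<close>
  show ?thesis
  proof (intro exI[of _ "2 * pi / L * (real N + 1)"] conjI allI impI)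
    show "0 < 2 * pi / L * (real N + 1)" using L by (auto intro!: mult_pos_pos)
  next
    fix f A m u1 u2 t
    assume f: "in_L2per f" and fn: "L2norm L f = nf" and A: "H2_compact L A"
      and m: "real m \<ge> L / (2 * pi) * (2 * pi / L * (real N + 1)) - 1"
      and u: "complete_trajectory_in L \<gamma> f A u1" "complete_trajectory_in L \<gamma> f A u2"
      and P: "\<forall>t. proj m (u1 t) = proj m (u2 t)"
    have Nm: "N \<le> m" using m L by simp
    have nf': "l2norm f \<le> nf / sqrt L" using L fn by (simp add: L2norm_l2norm field_simps)
    obtain ut where ut: "nls_trajectory L \<gamma> f u1 ut"
      by (rule complete_trajectory_is_nls_trajectory[OF L g f A u(1)])
    obtain vt where vt: "nls_trajectory L \<gamma> f u2 vt"
      by (rule complete_trajectory_is_nls_trajectory[OF L g f A u(2)])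
    interpret U: nls_trajectory L \<gamma> f u1 ut by (rule ut)
    interpret V: nls_trajectory L \<gamma> f u2 vt by (rule vt)
    show "u1 t = u2 t"
    proof (rule trajectories_coincide[OF ut vt, where B = R and \<epsilon> = \<epsilon>])
      fix s
      have low: "u1 s k - u2 s k = 0" if "\<bar>k\<bar> \<le> int m" for k
        using P that unfolding proj_def by (metis (mono_tags) cancel_comm_monoid_add_class.diff_cancel)
      have "in_L2per (Dx L (\<lambda>k. u1 s k - u2 s k))"
        unfolding Dx_diff by (intro in_L2per_diff U.Du2 V.Du2)
      then show "l1norm (\<lambda>k. u1 s k - u2 s k) \<le> \<epsilon> * l2norm (Dx L (\<lambda>k. u1 s k - u2 s k))"
        using low by (intro N[OF Nm]) auto
    qed (use R[OF ut nf'] R[OF vt nf'] e e' in auto)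
  qed
qed

theorem theorem3p1:
  shows "\<exists>K11 :: real \<Rightarrow> real \<Rightarrow> real \<Rightarrow> real.
    (\<forall>\<gamma> nf L. K11 \<gamma> nf L > 0) \<and>
    (\<forall>(L::real) (\<gamma>::real) (f::fcoef) A (m::nat) u1 u2.
       0 < L \<longrightarrow> 0 < \<gamma> \<longrightarrow> in_L2per f \<longrightarrow> f \<noteq> (\<lambda>k. 0) \<longrightarrow>
       is_global_attractor L \<gamma> f A \<longrightarrow>
       real m \<ge> L / (2 * pi) * K11 \<gamma> (L2norm L f) L - 1 \<longrightarrow>
       complete_trajectory_in L \<gamma> f A u1 \<longrightarrow>
       complete_trajectory_in L \<gamma> f A u2 \<longrightarrow>
       (\<forall>t. proj m (u1 t) = proj m (u2 t)) \<longrightarrow>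
       (\<forall>t. u1 t = u2 t))"
proof -
  \<comment> \<open>With f, the attractor and the trajectories quantified inside,
    \<open>good\<close> depends on \<gamma>, nf and L only, so choosing K for each triple gives a
    constant that is a function of these three.\<close>
  define good where "good \<gamma> nf L K \<longleftrightarrow> 0 < K \<and> (\<forall>f A (m::nat) u1 u2.
       0 < L \<longrightarrow> 0 < \<gamma> \<longrightarrow> in_L2per f \<longrightarrow> L2norm L f = nf \<longrightarrow> H2_compact L A \<longrightarrow>
       real m \<ge> L / (2 * pi) * K - 1 \<longrightarrow>
       complete_trajectory_in L \<gamma> f A u1 \<longrightarrow> complete_trajectory_in L \<gamma> f A u2 \<longrightarrow>
       (\<forall>t. proj m (u1 t) = proj m (u2 t)) \<longrightarrow> (\<forall>t. u1 t = u2 t))" for \<gamma> nf L K :: real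
  have "\<exists>K. good \<gamma> nf L K" for \<gamma> nf L
    unfolding good_def by (rule determining_modes)
  then obtain K11 where K11: "\<And>\<gamma> nf L. good \<gamma> nf L (K11 \<gamma> nf L)" by metis
  show ?thesis
  proof (intro exI[of _ K11] conjI allI impI)
    show "0 < K11 \<gamma> nf L" for \<gamma> nf L using K11[of \<gamma> nf L] unfolding good_def by blast
  next
    fix L \<gamma> :: real and f A m u1 u2 t
    assume *: "0 < L" "0 < \<gamma>" "in_L2per f" "is_global_attractor L \<gamma> f A"
      "real m \<ge> L / (2 * pi) * K11 \<gamma> (L2norm L f) L - 1"
      "complete_trajectory_in L \<gamma> f A u1" "complete_trajectory_in L \<gamma> f A u2"
      "\<forall>t. proj m (u1 t) = proj m (u2 t)"
    then have "H2_compact L A" by (simp add: is_global_attractor_def)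
    with * K11[of \<gamma> "L2norm L f" L] show "u1 t = u2 t" unfolding good_def by blast
  qed
qed

end
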